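(* For every integer $N\ge4$, there exist at least $2\left\lfloor\frac{N-1}{2}\right\rfloor$ pairwise non-isomorphic indecomposable deformed $N$-permutahedra which are not normally equivalent to matroid polytopes.
   Context: A polytope $\mathsf Q$ is a deformation of a polytope $\mathsf P$ if $\lambda\mathsf P=\mathsf Q+\mathsf R$ for some $\lambda>0$ and some polytope $\mathsf R$. A polytope $\mathsf P$ is indecomposable if its only deformations are $\lambda\mathsf P+t$ with $\lambda\ge0$ and $t$ a vector. The $N$-permutahedron is the convex hull of the permutations of $(1,\dots,N)$ in $\mathbb R^N$; a deformed $N$-permutahedron is a deformation of it (equivalently, a polytope in $\mathbb R^N$ all of whose edges are parallel to $e_i-e_j$ for some $i,j$). Two polytopes are isomorphic if their face lattices are isomorphic. Two polytopes in the same space are normally equivalent if they have the same normal fan. The matroid polytope of a matroid $M$ on $[N]$ is $\mathrm{conv}\{\sum_{x\in B}e_x: B\text{ a basis of }M\}\subset\mathbb R^N$. *)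

theory Defs
  imports "HOL-Analysis.Analysis" "HOL-Library.Set_Algebras"
begin

text \<open>The library counts the empty set as a polytope. Polytopes here are nonempty; otherwise
  \<open>{} = Q + {}\<close> would make every \<open>Q\<close> a deformation of \<open>{}\<close>. The sum of sets is
  the Minkowski sum.\<close>

definition is_deformation :: "'a::euclidean_space set \<Rightarrow> 'a set \<Rightarrow> bool" where
  "is_deformation Q P \<longleftrightarrow>
     polytope P \<and> P \<noteq> {} \<and> polytope Q \<and> Q \<noteq> {} \<and>
     (\<exists>l>0. \<exists>R. polytope R \<and> R \<noteq> {} \<and> (*\<^sub>R) l ` P = Q + R)"

definition indecomposable :: "'a::euclidean_space set \<Rightarrow> bool" where
  "indecomposable P \<longleftrightarrow>
     polytope P \<and> P \<noteq> {} \<and>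
     (\<forall>Q. is_deformation Q P \<longrightarrow> (\<exists>l\<ge>0. \<exists>t. Q = (\<lambda>x. l *\<^sub>R x + t) ` P))"

text \<open>The coordinates of \<open>\<real>\<^sup>N\<close> are indexed by a finite type \<open>'n\<close> with \<open>N\<close> elements, so a
  permutation of \<open>(1, \<dots>, N)\<close> is a bijection from \<open>'n\<close> onto \<open>{1..N}\<close>.\<close>

definition permutahedron :: "(real ^ 'n) set" where
  "permutahedron =
     convex hull {(\<chi> i. real (p i)) | p. bij_betw p (UNIV :: 'n set) {1..CARD('n)}}"

definition deformed_permutahedron :: "(real ^ 'n) set \<Rightarrow> bool" where
  "deformed_permutahedron P \<longleftrightarrow> is_deformation P permutahedron"

text \<open>An isomorphism of lattices is the same as an isomorphism of the underlying orders. The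
  relation \<open>face_of\<close> includes the empty face and the polytope itself.\<close>

definition isomorphic_polytopes :: "'a::euclidean_space set \<Rightarrow> 'b::euclidean_space set \<Rightarrow> bool" where
  "isomorphic_polytopes P Q \<longleftrightarrow>
     (\<exists>f. bij_betw f {F. F face_of P} {G. G face_of Q} \<and>
          (\<forall>F F'. F face_of P \<longrightarrow> F' face_of P \<longrightarrow> (F \<subseteq> F' \<longleftrightarrow> f F \<subseteq> f F')))"

definition normal_cone :: "'a::euclidean_space set \<Rightarrow> 'a set \<Rightarrow> 'a set" where
  "normal_cone P F = {c. \<forall>x\<in>F. \<forall>y\<in>P. c \<bullet> y \<le> c \<bullet> x}"

definition normal_fan :: "'a::euclidean_space set \<Rightarrow> 'a set set" where
  "normal_fan P = {normal_cone P F | F. F face_of P \<and> F \<noteq> {}}"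

definition normally_equivalent :: "'a::euclidean_space set \<Rightarrow> 'a set \<Rightarrow> bool" where
  "normally_equivalent P Q \<longleftrightarrow> normal_fan P = normal_fan Q"

text \<open>A matroid with ground set \<open>UNIV\<close> is represented by its set of bases.\<close>

definition matroid_bases :: "'n set set \<Rightarrow> bool" where
  "matroid_bases \<B> \<longleftrightarrow>
     \<B> \<noteq> {} \<and>
     (\<forall>A\<in>\<B>. \<forall>B\<in>\<B>. \<forall>x\<in>A - B. \<exists>y\<in>B - A. insert y (A - {x}) \<in> \<B>)"

definition matroid_polytope :: "'n set set \<Rightarrow> (real ^ 'n) set" where
  "matroid_polytope \<B> = convex hull ((\<lambda>B. \<Sum>x\<in>B. axis x 1) ` \<B>)"

end

theory Submission
  imports Defs
begin

text \<open>A deformed permutahedron is the base polytope of a submodular set function \<open>f\<close>: a polytope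
  \<open>P\<close> with support function \<open>f\<close> on indicator vectors, such that every total order of the
  coordinates has a point of \<open>P\<close> attaining \<open>f\<close> on all its initial segments. Subtracting \<open>f\<close> from a
  large multiple of the strictly submodular function of the permutahedron leaves a submodular
  function, whose base polytope is the complementary summand. A deformation of \<open>P\<close>, like a polytope
  with the same normal fan, has a submodular function that is tight wherever \<open>f\<close> is. So if tightness
  determines \<open>f\<close> up to scaling and modular functions, then \<open>P\<close> is indecomposable and every normally
  equivalent polytope is homothetic to \<open>P\<close>. Homothety to a matroid polytope is impossible once the
  marginals \<open>f (A \<union> {i}) - f A\<close> take three values for some \<open>i\<close>.

  With \<open>n = N - 1\<close>, this applies to the slabs \<open>a \<le> \<Sum>i. x\<^sub>i \<le> b\<close> of the \<open>n\<close>-cube with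
  \<open>a \<in> {0, 1}\<close> and \<open>a + 2 \<le> b < n\<close>, and to a pyramid stacked on a square face of the cuboctahedron.
  Their numbers of vertices (sums of binomial coefficients, and 13) are pairwise distinct, and there
  are \<open>2 n - 4\<close> of them.\<close>

section \<open>Base polytopes of submodular functions\<close>

text \<open>Encodes a total order by positions counted from 0, so that \<open>{i. c i < c k}\<close>
  is the set of predecessors of \<open>k\<close> and \<open>{i. c i < t}\<close> has exactly
  \<open>t\<close> elements for \<open>t <= CARD('n)\<close>.\<close>

definition ranking :: "('n::finite \<Rightarrow> nat) \<Rightarrow> bool" where
  "ranking c \<longleftrightarrow> bij_betw c UNIV {..<CARD('n)}"

lemma rankingD:
  fixes c :: "'n::finite \<Rightarrow> nat"
  assumes "ranking c"
  shows "c i = c j \<longleftrightarrow> i = j" and "c i < CARD('n)"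
    and "\<And>t. t \<le> CARD('n) \<Longrightarrow> card {i. c i < t} = t"
proof -
  have b: "bij_betw c UNIV {..<CARD('n)}" using assms by (simp add: ranking_def)
  then have inj: "inj c" by (rule bij_betw_imp_inj_on)
  then show "c i = c j \<longleftrightarrow> i = j" by (simp add: inj_eq)
  show "c i < CARD('n)" using bij_betw_apply[OF b, of i] by simp
  fix t :: nat assume "t \<le> CARD('n)"
  have "c ` {i. c i < t} = {..<t}"
  proof
    show "{..<t} \<subseteq> c ` {i. c i < t}"
    proof
      fix k assume "k \<in> {..<t}"
      then have "k \<in> c ` UNIV" using b \<open>t \<le> CARD('n)\<close> by (auto simp: bij_betw_def)
      then show "k \<in> c ` {i. c i < t}" using \<open>k \<in> {..<t}\<close> by auto
    qed
  qed auto
  moreover have "card (c ` {i. c i < t}) = card {i. c i < t}"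
    by (rule card_image) (use inj in \<open>auto intro: inj_on_subset\<close>)
  ultimately show "card {i. c i < t} = t" by simp
qed

lemma initial_segment_Suc:
  assumes "ranking c"
  shows "{i. c i < Suc (c k)} = insert k {i. c i < c k}"
  using rankingD(1)[OF assms] by (auto simp: less_Suc_eq)

lemma initial_segment_UNIV:
  fixes c :: "'n::finite \<Rightarrow> nat"
  assumes "ranking c"
  shows "{i. c i < CARD('n)} = UNIV"
  using rankingD(2)[OF assms] by auto

text \<open>Each step is indexed by the element \<open>k\<close> that enters, not by its position.
  For \<open>t\<close> past the last position the segment no longer changes.\<close>

lemma initial_segment_induct [consumes 1, case_names 0 Suc]:
  fixes c :: "'n::finite \<Rightarrow> nat"
  assumes "ranking c" and "P {}"
    and step: "\<And>k. P {i. c i < c k} \<Longrightarrow> P (insert k {i. c i < c k})"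
  shows "P {i. c i < t}"
proof (induction t)
  case 0 then show ?case using assms by simp
next
  case (Suc t)
  show ?case
  proof (cases "\<exists>k. c k = t")
    case True
    then obtain k where "c k = t" by blast
    then show ?thesis using step[of k] Suc initial_segment_Suc[OF assms(1), of k] by simp
  next
    case False
    then have "{i. c i < Suc t} = {i. c i < t}" by (auto simp: less_Suc_eq)
    then show ?thesis using Suc by simp
  qed
qed

text \<open>Sort by decreasing \<open>w\<close>, breaking ties by an injection into the naturals;
  the position of \<open>i\<close> is the number of its strict predecessors.\<close>

lemma exists_ranking:
  fixes w :: "'n::finite \<Rightarrow> real"
  obtains c where "ranking c" and "\<And>i j. c i < c j \<Longrightarrow> w j \<le> w i"
proof -
  obtain h :: "'n \<Rightarrow> nat" where h: "inj h"
    using finite_imp_inj_to_nat_seg[OF finite] by blast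
  define p where "p i j \<longleftrightarrow> w i > w j \<or> (w i = w j \<and> h i < h j)" for i j
  define c where "c i = card {j. p j i}" for i
  have tot: "i = j \<or> p i j \<or> p j i" for i j
    using h by (auto simp: p_def inj_eq) (metis inj_eq linorder_neqE_nat linorder_neqE_linordered_idom)
  have mono: "c i < c j" if "p i j" for i j
    unfolding c_def
  proof (rule psubset_card_mono)
    show "{k. p k i} \<subset> {k. p k j}" using that by (auto simp: p_def)
  qed simp
  have inj: "inj c"
  proof (rule injI)
    fix i j assume "c i = c j"
    then show "i = j" using tot[of i j] mono[of i j] mono[of j i] by auto
  qed
  have "c i < CARD('n)" for i
    unfolding c_def by (rule psubset_card_mono) (auto simp: p_def)
  then have "c ` UNIV \<subseteq> {..<CARD('n)}" by auto
  moreover have "card (c ` UNIV) = CARD('n)" by (rule card_image[OF inj])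
  ultimately have "c ` UNIV = {..<CARD('n)}" by (simp add: card_subset_eq)
  then have "ranking c" using inj by (simp add: ranking_def bij_betw_def)
  moreover have "w j \<le> w i" if "c i < c j" for i j
    using tot[of i j] mono[of j i] that by (auto simp: p_def)
  ultimately show thesis by (rule that)
qed

lemma initial_segmentI:
  fixes c :: "'n::finite \<Rightarrow> nat"
  assumes "\<And>i j. i \<in> A \<Longrightarrow> j \<notin> A \<Longrightarrow> c i < c j"
  shows "\<exists>t. {i. c i < t} = A"
proof (cases "A = UNIV")
  case True
  have "{i. c i < Suc (Max (range c))} = A"
    using True by (auto simp: less_Suc_eq_le)
  then show ?thesis by blast
next
  case False
  then obtain j where j: "j \<notin> A" "\<And>k. k \<notin> A \<Longrightarrow> c j \<le> c k"
    using ex_has_least_nat[of "\<lambda>k. k \<notin> A" _ c] by blast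
  have "{i. c i < c j} = A"
    using j assms by (force simp: not_less)
  then show ?thesis by blast
qed

text \<open>Sorting by the sum of the three indicators lists \<open>A\<close> first, then
  \<open>B - A\<close>, then \<open>C - B\<close>, then the rest.\<close>

lemma exists_ranking_chain:
  fixes A B C :: "'n::finite set"
  assumes "A \<subseteq> B" "B \<subseteq> C"
  obtains c where "ranking c" and "\<exists>t. {i. c i < t} = A" and "\<exists>t. {i. c i < t} = B"
    and "\<exists>t. {i. c i < t} = C"
proof -
  define w where "w i = (indicator A i + indicator B i + indicator C i :: real)" for i
  obtain c where c: "ranking c" "\<And>i j. c i < c j \<Longrightarrow> w j \<le> w i" using exists_ranking by blast
  have le: "c i < c j" if "w j < w i" for i j
    using c(2)[of j i] rankingD(1)[OF c(1), of i j] that by (cases "c i" "c j" rule: linorder_cases) auto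
  show thesis
    by (rule that[OF c(1)]; rule initial_segmentI; rule le)
      (use assms in \<open>auto simp: w_def indicator_def\<close>)
qed

section \<open>Tight points and uniqueness of the base polytope\<close>

abbreviation weight :: "real ^ 'n::finite \<Rightarrow> 'n set \<Rightarrow> real" where
  "weight x A \<equiv> (\<Sum>i\<in>A. x $ i)"

text \<open>For a polytope, this says that \<open>P\<close> is the base polytope of the submodular function \<open>f\<close>. It is
  phrased so that the Minkowski sum of \<open>P\<close> and \<open>Q\<close> visibly belongs to \<open>f + g\<close>.\<close>

definition base_polytope :: "(real ^ 'n::finite) set \<Rightarrow> ('n set \<Rightarrow> real) \<Rightarrow> bool" where
  "base_polytope P f \<longleftrightarrow>
     polytope P \<and>
     (\<forall>x\<in>P. (\<forall>A. weight x A \<le> f A) \<and> weight x UNIV = f UNIV) \<and>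
     (\<forall>c. ranking c \<longrightarrow> (\<exists>x\<in>P. \<forall>t. weight x {i. c i < t} = f {i. c i < t}))"

lemma base_polytopeD:
  assumes "base_polytope P f"
  shows "polytope P" and "x \<in> P \<Longrightarrow> weight x A \<le> f A" and "x \<in> P \<Longrightarrow> weight x UNIV = f UNIV"
    and "ranking c \<Longrightarrow> \<exists>x\<in>P. \<forall>t. weight x {i. c i < t} = f {i. c i < t}"
  using assms by (auto simp: base_polytope_def)

lemma base_polytope_chain:
  assumes "base_polytope P f" "A \<subseteq> B" "B \<subseteq> C"
  obtains x where "x \<in> P" "weight x A = f A" "weight x B = f B" "weight x C = f C"
proof -
  obtain c where "ranking c" and t: "\<exists>t. {i. c i < t} = A" "\<exists>t. {i. c i < t} = B"
    "\<exists>t. {i. c i < t} = C"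
    using exists_ranking_chain[OF assms(2,3)] by blast
  then obtain x where x: "x \<in> P" "\<And>t. weight x {i. c i < t} = f {i. c i < t}"
    using base_polytopeD(4)[OF assms(1)] by blast
  show thesis
  proof (rule that[OF x(1)])
    show "weight x A = f A" using x(2) t(1) by metis
    show "weight x B = f B" using x(2) t(2) by metis
    show "weight x C = f C" using x(2) t(3) by metis
  qed
qed

lemma base_polytope_nonempty: "base_polytope P f \<Longrightarrow> P \<noteq> {}"
  using base_polytope_chain[of P f "{}" "{}" "{}"] by blast

lemma base_polytope_empty: "base_polytope P f \<Longrightarrow> f {} = 0"
  using base_polytope_chain[of P f "{}" "{}" "{}"] by force

lemma base_polytope_attains:
  assumes "base_polytope P f"
  obtains x where "x \<in> P" "weight x A = f A"
  using base_polytope_chain[OF assms, of A A A] by blast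

lemma weight_modular: "weight x A + weight x B = weight x (A \<inter> B) + weight x (A \<union> B)"
  using sum.union_inter[of A B "\<lambda>i. x $ i"] by simp

text \<open>At a point tight on \<open>A \<inter> B\<close>, \<open>A\<close> and
  \<open>A \<union> B\<close>, modularity of weights and the assumption leave no slack at
  \<open>B\<close>.\<close>

lemma base_polytope_tight_point:
  assumes "base_polytope P f" and "f A + f B \<le> f (A \<inter> B) + f (A \<union> B)"
  obtains x where "x \<in> P" "weight x (A \<inter> B) = f (A \<inter> B)" "weight x A = f A" "weight x B = f B"
    "weight x (A \<union> B) = f (A \<union> B)"
proof -
  obtain x where x: "x \<in> P" "weight x (A \<inter> B) = f (A \<inter> B)" "weight x A = f A"
    "weight x (A \<union> B) = f (A \<union> B)"
    using base_polytope_chain[OF assms(1), of "A \<inter> B" A "A \<union> B"] by blast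
  moreover have "weight x B = f B"
    using weight_modular[of x A B] x assms(2) base_polytopeD(2)[OF assms(1) x(1), of B] by linarith
  ultimately show thesis using that by blast
qed

text \<open>At a point tight on \<open>A \<inter> B\<close> and \<open>A \<union> B\<close>, the
  left side is the total weight of \<open>A\<close> and \<open>B\<close>, which the bounds on
  \<open>P\<close> limit.\<close>

lemma base_polytope_submodular:
  assumes "base_polytope P f"
  shows "f (A \<inter> B) + f (A \<union> B) \<le> f A + f B"
proof -
  obtain x where x: "x \<in> P" "weight x (A \<inter> B) = f (A \<inter> B)" "weight x (A \<union> B) = f (A \<union> B)"
    using base_polytope_chain[OF assms, of "A \<inter> B" A "A \<union> B"] by blast
  show ?thesis
    using weight_modular[of x A B] x base_polytopeD(2)[OF assms x(1), of A]
      base_polytopeD(2)[OF assms x(1), of B] by linarith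
qed

text \<open>Abel summation: a weight decreasing along the order is, up to a constant, a nonnegative
  combination of indicators of initial segments.\<close>

lemma sum_decreasing_weight_nonneg:
  fixes c :: "'n::finite \<Rightarrow> nat" and w z :: "'n \<Rightarrow> real"
  assumes c: "ranking c" and w: "\<And>i j. c i < c j \<Longrightarrow> w j \<le> w i"
    and z: "\<And>t. 0 \<le> sum z {i. c i < t}" and z0: "sum z UNIV = 0"
  shows "0 \<le> (\<Sum>i\<in>UNIV. w i * z i)"
proof -
  \<comment> \<open>Every lower bound \<open>m\<close> is allowed because appending \<open>k\<close>
    invokes the induction hypothesis with \<open>m = w k\<close>.\<close>
  have *: "\<forall>m. (\<forall>i\<in>{i. c i < t}. m \<le> w i) \<longrightarrow> 0 \<le> (\<Sum>i\<in>{i. c i < t}. (w i - m) * z i)" for t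
    using c
  proof (induction t rule: initial_segment_induct)
    case 0 then show ?case by simp
  next
    case (Suc k)
    show ?case
    proof (intro allI impI)
      fix m assume m: "\<forall>i\<in>insert k {i. c i < c k}. m \<le> w i"
      let ?L = "{i. c i < c k}"
      have "(\<Sum>i\<in>insert k ?L. (w i - m) * z i) = (w k - m) * z k + (\<Sum>i\<in>?L. (w i - m) * z i)"
        by simp
      also have "(\<Sum>i\<in>?L. (w i - m) * z i) = (\<Sum>i\<in>?L. (w i - w k) * z i) + (w k - m) * sum z ?L"
        by (simp add: sum_distrib_left flip: sum.distrib) (simp add: algebra_simps)
      finally have "(\<Sum>i\<in>insert k ?L. (w i - m) * z i)
          = (\<Sum>i\<in>?L. (w i - w k) * z i) + (w k - m) * sum z (insert k ?L)"
        by (simp add: algebra_simps)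
      moreover have "0 \<le> (\<Sum>i\<in>?L. (w i - w k) * z i)" using Suc w by simp
      moreover have "0 \<le> sum z (insert k ?L)"
        using z[of "Suc (c k)"] initial_segment_Suc[OF c, of k] by simp
      ultimately show "0 \<le> (\<Sum>i\<in>insert k ?L. (w i - m) * z i)" using m by simp
    qed
  qed
  \<comment> \<open>Subtracting a constant from \<open>w\<close> is harmless, as \<open>z\<close>
    sums to zero.\<close>
  let ?m = "Min (range w)"
  have "0 \<le> (\<Sum>i\<in>UNIV. (w i - ?m) * z i)"
    using *[of "CARD('n)"] initial_segment_UNIV[OF c] by simp
  also have "\<dots> = (\<Sum>i\<in>UNIV. w i * z i) - ?m * sum z UNIV"
    by (simp add: sum_distrib_left left_diff_distrib sum_subtractf)
  finally show ?thesis using z0 by simp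
qed

text \<open>If a hyperplane separated \<open>y\<close> from \<open>Q\<close>, sort the coordinates
  by the direction in which \<open>y\<close> lies beyond \<open>Q\<close>. The point of
  \<open>Q\<close> tight along that order does at least as well as \<open>y\<close> in this
  direction, a contradiction.\<close>

lemma base_polytope_subset:
  assumes P: "base_polytope P f" and Q: "base_polytope Q f"
  shows "P \<subseteq> Q"
proof
  fix y assume y: "y \<in> P"
  show "y \<in> Q"
  proof (rule ccontr)
    assume "y \<notin> Q"
    moreover have "convex Q" "closed Q"
      using base_polytopeD(1)[OF Q] by (simp_all add: polytope_imp_convex polytope_imp_closed)
    ultimately obtain a b where ab: "a \<bullet> y < b" "\<And>x. x \<in> Q \<Longrightarrow> a \<bullet> x > b"
      using separating_hyperplane_closed_point[of Q y] by blast
    define w where "w i = - a $ i" for i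
    obtain c where c: "ranking c" "\<And>i j. c i < c j \<Longrightarrow> w j \<le> w i" using exists_ranking by blast
    obtain x where x: "x \<in> Q" "\<And>t. weight x {i. c i < t} = f {i. c i < t}"
      using base_polytopeD(4)[OF Q c(1)] by blast
    have "0 \<le> (\<Sum>i\<in>UNIV. w i * (x $ i - y $ i))"
    proof (rule sum_decreasing_weight_nonneg[OF c])
      show "0 \<le> (\<Sum>i | c i < t. x $ i - y $ i)" for t
        using x(2)[of t] base_polytopeD(2)[OF P y, of "{i. c i < t}"] by (simp add: sum_subtractf)
      show "(\<Sum>i\<in>UNIV. x $ i - y $ i) = 0"
        using base_polytopeD(3)[OF Q x(1)] base_polytopeD(3)[OF P y] by (simp add: sum_subtractf)
    qed
    also have "\<dots> = a \<bullet> y - a \<bullet> x"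
      by (simp add: w_def inner_vec_def right_diff_distrib sum_subtractf sum_negf)
    finally show False using ab(1) ab(2)[OF x(1)] by simp
  qed
qed

lemma base_polytope_unique: "base_polytope P f \<Longrightarrow> base_polytope Q f \<Longrightarrow> P = Q"
  by (simp add: base_polytope_subset subset_antisym)

lemma polytope_set_plus:
  fixes P Q :: "'a::euclidean_space set"
  assumes "polytope P" "polytope Q"
  shows "polytope (P + Q)"
  using assms unfolding polytope_def by (metis convex_hull_set_plus finite_set_plus)

lemma base_polytope_set_plus:
  assumes P: "base_polytope P f" and Q: "base_polytope Q g"
  shows "base_polytope (P + Q) (\<lambda>A. f A + g A)"
  unfolding base_polytope_def
proof (intro conjI ballI allI impI)
  show "polytope (P + Q)" using P Q by (simp add: base_polytopeD polytope_set_plus)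
next
  fix x A assume "x \<in> P + Q"
  then obtain y z where "x = y + z" "y \<in> P" "z \<in> Q" by (rule set_plus_elim)
  then show "weight x A \<le> f A + g A" and "weight x UNIV = f UNIV + g UNIV"
    using base_polytopeD(2,3)[OF P, of y] base_polytopeD(2,3)[OF Q, of z]
    by (simp_all add: sum.distrib add_mono)
next
  fix c :: "'a \<Rightarrow> nat" assume "ranking c"
  then obtain y z where "y \<in> P" "z \<in> Q" "\<And>t. weight y {i. c i < t} = f {i. c i < t}"
    "\<And>t. weight z {i. c i < t} = g {i. c i < t}"
    using base_polytopeD(4)[OF P] base_polytopeD(4)[OF Q] by blast
  then show "\<exists>x\<in>P + Q. \<forall>t. weight x {i. c i < t} = f {i. c i < t} + g {i. c i < t}"
    by (intro bexI[of _ "y + z"]) (auto simp: sum.distrib)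
qed

lemma base_polytope_homothety:
  assumes P: "base_polytope P f" and "l \<ge> 0"
  shows "base_polytope ((\<lambda>x. l *\<^sub>R x + t) ` P) (\<lambda>A. l * f A + weight t A)"
  unfolding base_polytope_def
proof (intro conjI ballI allI impI)
  have "(\<lambda>x. l *\<^sub>R x + t) ` P = (+) t ` ((*\<^sub>R) l ` P)" by (auto simp: image_image add.commute)
  then show "polytope ((\<lambda>x. l *\<^sub>R x + t) ` P)"
    using base_polytopeD(1)[OF P] by (simp add: polytope_translation_eq polytope_scaling)
next
  have w: "weight (l *\<^sub>R x + t) A = l * weight x A + weight t A" for x A
    by (simp add: sum.distrib sum_distrib_left)
  {
    fix x A assume "x \<in> (\<lambda>x. l *\<^sub>R x + t) ` P"
    then obtain y where y: "y \<in> P" "x = l *\<^sub>R y + t" by blast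
    show "weight x A \<le> l * f A + weight t A" and "weight x UNIV = l * f UNIV + weight t UNIV"
      unfolding y(2) w
      using base_polytopeD(2)[OF P y(1), of A] base_polytopeD(3)[OF P y(1)] \<open>l \<ge> 0\<close>
      by (simp_all add: mult_left_mono)
  }
  fix c :: "'a \<Rightarrow> nat" assume "ranking c"
  then show "\<exists>x\<in>(\<lambda>x. l *\<^sub>R x + t) ` P.
      \<forall>u. weight x {i. c i < u} = l * f {i. c i < u} + weight t {i. c i < u}"
    using base_polytopeD(4)[OF P, of c] by (auto simp only: w bex_simps image_iff) (metis w)
qed

section \<open>The greedy algorithm\<close>

text \<open>The vertex found by Edmonds' greedy algorithm: each coordinate is the marginal value
  over its predecessors.\<close>

definition greedy_point :: "('n::finite set \<Rightarrow> real) \<Rightarrow> ('n \<Rightarrow> nat) \<Rightarrow> real ^ 'n" where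
  "greedy_point f c = (\<chi> k. f (insert k {i. c i < c k}) - f {i. c i < c k})"

lemma weight_greedy_point:
  assumes "ranking c" and "f {} = 0"
  shows "weight (greedy_point f c) {i. c i < t} = f {i. c i < t}"
  using assms(1)
proof (induction t rule: initial_segment_induct)
  case 0 then show ?case using assms by simp
next
  case (Suc k) then show ?case by (simp add: greedy_point_def)
qed

text \<open>Diminishing marginals: along the order, an element of \<open>A\<close> contributes its
  marginal over all its predecessors, which is at most its marginal over those in
  \<open>A\<close>.\<close>

lemma weight_greedy_point_le:
  fixes c :: "'n::finite \<Rightarrow> nat"
  assumes c: "ranking c" and "f {} = 0"
    and sub: "\<And>A B. f (A \<inter> B) + f (A \<union> B) \<le> f A + f B"
  shows "weight (greedy_point f c) A \<le> f A"
proof -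
  have "weight (greedy_point f c) (A \<inter> {i. c i < t}) \<le> f (A \<inter> {i. c i < t})" for t
    using c
  proof (induction t rule: initial_segment_induct)
    case 0 then show ?case using assms by simp
  next
    case (Suc k)
    let ?L = "{i. c i < c k}"
    show ?case
    proof (cases "k \<in> A")
      case True
      then have "A \<inter> insert k ?L = insert k (A \<inter> ?L)" "insert k (A \<inter> ?L) \<inter> ?L = A \<inter> ?L"
        "insert k (A \<inter> ?L) \<union> ?L = insert k ?L" by auto
      then show ?thesis
        using Suc sub[of "insert k (A \<inter> ?L)" ?L] by (simp add: greedy_point_def)
    next
      case False
      then show ?thesis using Suc by simp
    qed
  qed
  from this[of "CARD('n)"] show ?thesis using initial_segment_UNIV[OF c] by simp
qed

lemma finite_rankings: "finite {c::'n::finite \<Rightarrow> nat. ranking c}"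
proof (rule finite_subset)
  show "finite {c. \<forall>x. (x \<in> (UNIV::'n set) \<longrightarrow> c x \<in> {..<CARD('n)}) \<and> (x \<notin> UNIV \<longrightarrow> c x = (0::nat))}"
    by (rule finite_set_of_finite_funs) auto
qed (auto dest: rankingD(2))

lemma weight_eq_inner: "weight x A = (\<chi> i. indicator A i) \<bullet> x"
  by (simp add: inner_vec_def indicator_def if_distrib[where f = "\<lambda>x. x * _"] sum.If_cases)

lemma convex_weight_le: "convex {x. weight x A \<le> b}"
  unfolding weight_eq_inner by (rule convex_halfspace_le)

lemma convex_weight_eq: "convex {x. weight x A = b}"
  unfolding weight_eq_inner by (rule convex_hyperplane)

lemma base_polytope_convex_hull:
  fixes f :: "'n::finite set \<Rightarrow> real"
  assumes "finite V" and le: "\<And>x A. x \<in> V \<Longrightarrow> weight x A \<le> f A"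
    and eq: "\<And>x. x \<in> V \<Longrightarrow> weight x UNIV = f UNIV"
    and tight: "\<And>c. ranking c \<Longrightarrow> \<exists>x\<in>V. \<forall>t. weight x {i. c i < t} = f {i. c i < t}"
  shows "base_polytope (convex hull V) f"
  unfolding base_polytope_def
proof (intro conjI ballI allI impI)
  show "polytope (convex hull V)" using assms(1) by (rule polytope_convex_hull)
  fix x assume x: "x \<in> convex hull V"
  have "convex hull V \<subseteq> {x. weight x A \<le> f A}" for A
    by (rule hull_minimal) (use le in \<open>auto simp: convex_weight_le\<close>)
  then show "weight x A \<le> f A" for A using x by blast
  have "convex hull V \<subseteq> {x. weight x UNIV = f UNIV}"
    by (rule hull_minimal) (use eq in \<open>auto simp: convex_weight_eq\<close>)
  then show "weight x UNIV = f UNIV" using x by blast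
next
  fix c :: "'n \<Rightarrow> nat" assume "ranking c"
  then show "\<exists>x\<in>convex hull V. \<forall>t. weight x {i. c i < t} = f {i. c i < t}"
    using tight[of c] by (meson hull_inc)
qed

text \<open>The source of new base polytopes: it yields the permutahedron and the complementary
  summand of a deformation.\<close>

lemma base_polytope_greedy:
  fixes f :: "'n::finite set \<Rightarrow> real"
  assumes "f {} = 0" and sub: "\<And>A B. f (A \<inter> B) + f (A \<union> B) \<le> f A + f B"
  shows "base_polytope (convex hull (greedy_point f ` {c. ranking c})) f"
proof (rule base_polytope_convex_hull)
  show "finite (greedy_point f ` {c. ranking c})" by (simp add: finite_rankings)
  fix x A assume "x \<in> greedy_point f ` {c. ranking c}"
  then obtain c where c: "ranking c" "x = greedy_point f c" by blast
  show "weight x A \<le> f A" unfolding c(2) by (rule weight_greedy_point_le[OF c(1) assms])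
  show "weight x UNIV = f UNIV"
    using weight_greedy_point[of c f "CARD('n)", OF c(1) assms(1)] initial_segment_UNIV[OF c(1)] c(2)
    by simp
next
  fix c :: "'n \<Rightarrow> nat" assume "ranking c"
  then show "\<exists>x\<in>greedy_point f ` {c. ranking c}. \<forall>t. weight x {i. c i < t} = f {i. c i < t}"
    using weight_greedy_point[of c f] assms(1) by blast
qed

section \<open>Deformations, extreme rays and normal fans\<close>

text \<open>The sum of the \<open>card A\<close> largest elements of \<open>{1..CARD('n)}\<close>.\<close>

definition perm_fun :: "'n::finite set \<Rightarrow> real" where
  "perm_fun A = real (card A) * real CARD('n) - real (card A) * (real (card A) - 1) / 2"

text \<open>The submodularity defect is at least 1 on incomparable sets, so a large multiple of it
  outweighs the defect of any given function.\<close>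

lemma perm_fun_strict:
  fixes A B :: "'n::finite set"
  shows "perm_fun A + perm_fun B - perm_fun (A \<inter> B) - perm_fun (A \<union> B)
    = real (card (A - B)) * real (card (B - A))"
proof -
  have "card A = card (A \<inter> B) + card (A - B)"
    by (metis card_Int_Diff finite_class.finite)
  moreover have "card B = card (A \<inter> B) + card (B - A)"
    by (metis Int_commute card_Int_Diff finite_class.finite)
  moreover have "card (A \<union> B) = card (A \<inter> B) + card (A - B) + card (B - A)"
    using card_Un_Int[of A B] calculation by simp
  ultimately show ?thesis by (simp add: perm_fun_def field_simps)
qed

text \<open>The greedy points of \<open>perm_fun\<close> are exactly the permutations of
  \<open>(1, ..., N)\<close>.\<close>

lemma base_polytope_permutahedron: "base_polytope permutahedron (perm_fun :: 'n::finite set \<Rightarrow> real)"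
proof -
  let ?N = "CARD('n)"
  have greedy: "greedy_point perm_fun c = (\<chi> i. real (?N - c i))" if "ranking c" for c :: "'n \<Rightarrow> nat"
  proof -
    have "perm_fun (insert k {i. c i < c k}) - perm_fun {i. c i < c k} = real (?N - c k)" for k
    proof -
      have "card {i. c i < c k} = c k" "c k < ?N"
        using rankingD(2,3)[OF that] by (simp_all add: less_imp_le)
      then show ?thesis by (simp add: perm_fun_def field_simps of_nat_diff)
    qed
    then show ?thesis by (simp add: greedy_point_def)
  qed
  \<comment> \<open>Reflection turns positions counted from 0 into values in \<open>{1..?N}\<close>,
    the first position receiving the largest value.\<close>
  have refl: "bij_betw (\<lambda>m. ?N - m) {..<?N} {1..?N}" "bij_betw (\<lambda>m. ?N - m) {1..?N} {..<?N}"
    by (rule bij_betw_byWitness[where f' = "\<lambda>m. ?N - m"]; auto)+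
  have "{(\<chi> i. real (p i)) | p. bij_betw p (UNIV :: 'n set) {1..?N}}
      = greedy_point perm_fun ` {c. ranking c}"
  proof (intro subset_antisym subsetI)
    fix x assume "x \<in> greedy_point perm_fun ` {c :: 'n \<Rightarrow> nat. ranking c}"
    then obtain c :: "'n \<Rightarrow> nat" where c: "ranking c" "x = (\<chi> i. real (?N - c i))"
      using greedy by auto
    have "bij_betw (\<lambda>i. ?N - c i) UNIV {1..?N}"
      using bij_betw_trans[OF _ refl(1), of c UNIV] c(1) by (simp add: ranking_def comp_def)
    then show "x \<in> {(\<chi> i. real (p i)) | p. bij_betw p (UNIV :: 'n set) {1..?N}}"
      unfolding mem_Collect_eq using c(2) by (intro exI[of _ "\<lambda>i. ?N - c i"]) simp
  next
    fix x assume "x \<in> {(\<chi> i. real (p i)) | p. bij_betw p (UNIV :: 'n set) {1..?N}}"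
    then obtain p where p: "bij_betw p (UNIV :: 'n set) {1..?N}" "x = (\<chi> i. real (p i))" by blast
    define c where "c i = ?N - p i" for i
    have c: "ranking c"
      using bij_betw_trans[OF p(1) refl(2)] by (simp add: ranking_def comp_def c_def[abs_def])
    have "?N - c i = p i" for i
      using bij_betw_apply[OF p(1), of i] by (simp add: c_def)
    then have "x = greedy_point perm_fun c" by (simp add: greedy[OF c] p(2))
    then show "x \<in> greedy_point perm_fun ` {c. ranking c}" using c by blast
  qed
  moreover have "perm_fun (A \<inter> B) + perm_fun (A \<union> B) \<le> perm_fun A + perm_fun B" for A B :: "'n set"
  proof -
    have "0 \<le> real (card (A - B)) * real (card (B - A))" by simp
    then show ?thesis using perm_fun_strict[of A B] by linarith
  qed
  moreover have "perm_fun ({} :: 'n set) = 0" by (simp add: perm_fun_def)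
  ultimately show ?thesis
    unfolding permutahedron_def using base_polytope_greedy[of "perm_fun :: 'n set \<Rightarrow> real"] by simp
qed

text \<open>The base polytope of \<open>r\<close> is the complementary summand; uniqueness
  identifies its sum with \<open>P\<close> as the dilated permutahedron.\<close>

lemma base_polytope_deformed_permutahedron:
  fixes P :: "(real ^ 'n::finite) set"
  assumes P: "base_polytope P f"
  shows "deformed_permutahedron P"
proof -
  define D where "D A B = \<bar>f A + f B - f (A \<inter> B) - f (A \<union> B)\<bar>" for A B
  \<comment> \<open>Bounds the submodularity defect of \<open>f\<close> on all pairs at once; the
    summand 1 makes \<open>l\<close> positive.\<close>
  define l where "l = 1 + (\<Sum>A\<in>UNIV. \<Sum>B\<in>UNIV. D A B)"
  have Dl: "D A B \<le> l" for A B
  proof -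
    have "D A B \<le> (\<Sum>B\<in>UNIV. D A B)" by (rule member_le_sum) (auto simp: D_def)
    also have "\<dots> \<le> (\<Sum>A\<in>UNIV. \<Sum>B\<in>UNIV. D A B)"
      by (rule member_le_sum[of A UNIV "\<lambda>A. \<Sum>B\<in>UNIV. D A B"]) (auto simp: D_def intro: sum_nonneg)
    finally show ?thesis by (simp add: l_def)
  qed
  have "0 \<le> (\<Sum>A\<in>UNIV. \<Sum>B\<in>UNIV. D A B)" by (auto simp: D_def intro!: sum_nonneg)
  then have l: "l > 0" by (simp add: l_def)
  define r where "r A = l * perm_fun A - f A" for A
  have "r (A \<inter> B) + r (A \<union> B) \<le> r A + r B" for A B
  proof -
    have "f A + f B - f (A \<inter> B) - f (A \<union> B) \<le> l * (real (card (A - B)) * real (card (B - A)))"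
    proof (cases "A \<subseteq> B \<or> B \<subseteq> A")
      case True
      then have "f A + f B - f (A \<inter> B) - f (A \<union> B) = 0"
        by (auto simp: Int_absorb1 Int_absorb2 Un_absorb1 Un_absorb2)
      then show ?thesis using l by simp
    next
      case False
      then have "1 \<le> card (A - B)" "1 \<le> card (B - A)" by (auto simp: Suc_le_eq card_gt_0_iff)
      then have "1 \<le> card (A - B) * card (B - A)" by (metis mult_le_mono nat_mult_1)
      then have "1 \<le> real (card (A - B)) * real (card (B - A))"
        by (metis of_nat_1 of_nat_le_iff of_nat_mult)
      then have "l * 1 \<le> l * (real (card (A - B)) * real (card (B - A)))"
        using l by (intro mult_left_mono) auto
      then show ?thesis using Dl[of A B] by (simp add: D_def)
    qed
    then show ?thesis
      unfolding perm_fun_strict[symmetric] by (simp add: r_def algebra_simps)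
  qed
  moreover have "r {} = 0" using base_polytope_empty[OF P] by (simp add: r_def perm_fun_def)
  ultimately obtain R where R: "base_polytope R r" using base_polytope_greedy by blast
  have "base_polytope (P + R) (\<lambda>A. l * perm_fun A)"
    using base_polytope_set_plus[OF P R] by (simp add: r_def)
  moreover have "base_polytope ((*\<^sub>R) l ` permutahedron) (\<lambda>A::'n set. l * perm_fun A)"
    using base_polytope_homothety[OF base_polytope_permutahedron, of l 0] l by simp
  ultimately have "(*\<^sub>R) l ` permutahedron = P + R" by (rule base_polytope_unique[symmetric])
  then show ?thesis
    unfolding deformed_permutahedron_def is_deformation_def
    using l P R base_polytope_permutahedron by (metis base_polytopeD(1) base_polytope_nonempty)
qed

text \<open>\<open>f\<close> spans an extreme ray, modulo modular functions, of the cone of submodular functions.\<close>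

definition extreme_submodular :: "('n::finite set \<Rightarrow> real) \<Rightarrow> bool" where
  "extreme_submodular f \<longleftrightarrow>
     (\<forall>g. g {} = 0 \<longrightarrow>
          (\<forall>A B. g (A \<inter> B) + g (A \<union> B) \<le> g A + g B) \<longrightarrow>
          (\<forall>A B. f A + f B = f (A \<inter> B) + f (A \<union> B) \<longrightarrow> g A + g B = g (A \<inter> B) + g (A \<union> B)) \<longrightarrow>
          (\<exists>l\<ge>0. \<exists>t. \<forall>A. g A = l * f A + weight t A))"

lemma extreme_submodular_homothety:
  assumes ext: "extreme_submodular f" and Q: "base_polytope Q g"
    and tight: "\<And>A B. f A + f B = f (A \<inter> B) + f (A \<union> B) \<Longrightarrow> g A + g B = g (A \<inter> B) + g (A \<union> B)"
  obtains l t where "l \<ge> 0" "g = (\<lambda>A. l * f A + weight t A)"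
proof -
  have "\<exists>l\<ge>0. \<exists>t. \<forall>A. g A = l * f A + weight t A"
    using ext base_polytope_empty[OF Q] base_polytope_submodular[OF Q] tight
    unfolding extreme_submodular_def by blast
  then show thesis using that by blast
qed

lemma compact_weight_attains_max:
  fixes P :: "(real ^ 'n::finite) set"
  assumes "compact P" "P \<noteq> {}"
  obtains g where "\<And>A x. x \<in> P \<Longrightarrow> weight x A \<le> g A" "\<And>A. \<exists>x\<in>P. weight x A = g A"
proof -
  have "\<exists>m. (\<forall>x\<in>P. weight x A \<le> m) \<and> (\<exists>x\<in>P. weight x A = m)" for A
  proof -
    have "continuous_on P (\<lambda>x. weight x A)" by (intro continuous_intros)
    from continuous_attains_sup[OF assms this] show ?thesis by blast
  qed
  then show thesis using that by metis
qed

text \<open>A point of \<open>Q + R\<close> tight for the dilated \<open>f\<close> splits into tight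
  points of \<open>Q\<close> and \<open>R\<close>. This passes tight chains and tight pairs from
  \<open>P\<close> to \<open>Q\<close>, after which extremality makes \<open>g\<close> a multiple of
  \<open>f\<close> plus a modular function.\<close>

lemma base_polytope_indecomposable:
  fixes P :: "(real ^ 'n::finite) set"
  assumes P: "base_polytope P f" and ext: "extreme_submodular f"
  shows "indecomposable P"
  unfolding indecomposable_def
proof (intro conjI allI impI)
  show "polytope P" using P by (rule base_polytopeD(1))
  show "P \<noteq> {}" using P by (rule base_polytope_nonempty)
  fix Q assume "is_deformation Q P"
  then obtain l R where Q: "polytope Q" "Q \<noteq> {}" and R: "polytope R" "R \<noteq> {}" and l: "l > 0"
    and sum: "(*\<^sub>R) l ` P = Q + R"
    by (auto simp: is_deformation_def)
  obtain g where g: "\<And>A x. x \<in> Q \<Longrightarrow> weight x A \<le> g A" "\<And>A. \<exists>x\<in>Q. weight x A = g A"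
    using compact_weight_attains_max[OF polytope_imp_compact[OF Q(1)] Q(2)] by metis
  obtain r where r: "\<And>A x. x \<in> R \<Longrightarrow> weight x A \<le> r A" "\<And>A. \<exists>x\<in>R. weight x A = r A"
    using compact_weight_attains_max[OF polytope_imp_compact[OF R(1)] R(2)] by metis
  have lP: "base_polytope (Q + R) (\<lambda>A. l * f A)"
    using base_polytope_homothety[OF P, of l 0] l sum by simp
  \<comment> \<open>Support functions add under Minkowski sums.\<close>
  have lf: "l * f A = g A + r A" for A
  proof (rule antisym)
    obtain x where x: "x \<in> Q + R" "weight x A = l * f A" using base_polytope_attains[OF lP] by blast
    then obtain y z where "x = y + z" "y \<in> Q" "z \<in> R" by (auto elim: set_plus_elim)
    then show "l * f A \<le> g A + r A" using x g(1)[of y A] r(1)[of z A] by (simp add: sum.distrib)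
  next
    obtain y z where "y \<in> Q" "z \<in> R" "weight y A = g A" "weight z A = r A" using g(2) r(2) by meson
    then show "g A + r A \<le> l * f A"
      using base_polytopeD(2)[OF lP set_plus_intro, of y z A] by (simp add: sum.distrib)
  qed
  \<comment> \<open>Each summand is bounded separately, so equality in the sum forces equality in
    both.\<close>
  have split: "weight y A = g A" if "weight (y + z) A = l * f A" "y \<in> Q" "z \<in> R" for y z A
    using that g(1)[of y A] r(1)[of z A] lf[of A] by (simp add: sum.distrib)
  have baseQ: "base_polytope Q g"
    unfolding base_polytope_def
  proof (intro conjI ballI allI impI)
    show "polytope Q" by fact
    show "weight y A \<le> g A" if "y \<in> Q" for y A using g(1) that .
    show "weight y UNIV = g UNIV" if "y \<in> Q" for y
    proof -
      obtain z where "z \<in> R" using R by blast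
      then show ?thesis using split[of y z UNIV] base_polytopeD(3)[OF lP set_plus_intro, of y z] that by blast
    qed
    fix c :: "'n \<Rightarrow> nat" assume "ranking c"
    then obtain x where x: "x \<in> Q + R" "\<And>t. weight x {i. c i < t} = l * f {i. c i < t}"
      using base_polytopeD(4)[OF lP] by blast
    then obtain y z where "x = y + z" "y \<in> Q" "z \<in> R" by (auto elim: set_plus_elim)
    then show "\<exists>x\<in>Q. \<forall>t. weight x {i. c i < t} = g {i. c i < t}" using x(2) split by blast
  qed
  have "g A + g B = g (A \<inter> B) + g (A \<union> B)" if "f A + f B = f (A \<inter> B) + f (A \<union> B)" for A B
  proof -
    have "l * f A + l * f B \<le> l * f (A \<inter> B) + l * f (A \<union> B)"
      using that by (simp flip: distrib_left)
    then obtain x where x: "x \<in> Q + R" "weight x (A \<inter> B) = l * f (A \<inter> B)" "weight x A = l * f A"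
      "weight x B = l * f B" "weight x (A \<union> B) = l * f (A \<union> B)"
      by (rule base_polytope_tight_point[OF lP])
    then obtain y z where "x = y + z" "y \<in> Q" "z \<in> R" by (auto elim: set_plus_elim)
    then show ?thesis using split[of y z] x weight_modular[of y A B] by metis
  qed
  then obtain l' t where lt: "l' \<ge> 0" "g = (\<lambda>A. l' * f A + weight t A)"
    using extreme_submodular_homothety[OF ext baseQ] by blast
  have "Q = (\<lambda>x. l' *\<^sub>R x + t) ` P"
    using base_polytope_unique[OF baseQ] base_polytope_homothety[OF P lt(1), of t] lt(2) by simp
  then show "\<exists>l\<ge>0. \<exists>t. Q = (\<lambda>x. l *\<^sub>R x + t) ` P" using lt(1) by blast
qed

text \<open>The normal cone at a point is that of the smallest face containing the point.\<close>

lemma normal_fan_eq_point: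
  assumes fan: "normal_fan P = normal_fan M" and "convex P" and x: "x \<in> P"
  obtains q where "q \<in> M" "normal_cone P {x} \<subseteq> normal_cone M {q}"
proof -
  \<comment> \<open>Every functional maximal over \<open>P\<close> at \<open>x\<close> is constant
    on \<open>F\<close>, so the normal cone of \<open>F\<close> contains that of
    \<open>x\<close>.\<close>
  define F where "F = (\<Inter>w\<in>normal_cone P {x}. P \<inter> {y. w \<bullet> y = w \<bullet> x})"
  have "F face_of P"
    unfolding F_def
  proof (rule face_of_Inter)
    have "0 \<in> normal_cone P {x}" by (simp add: normal_cone_def)
    then show "(\<lambda>w. P \<inter> {y. w \<bullet> y = w \<bullet> x}) ` normal_cone P {x} \<noteq> {}" by blast
    show "T face_of P" if T: "T \<in> (\<lambda>w. P \<inter> {y. w \<bullet> y = w \<bullet> x}) ` normal_cone P {x}" for T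
      using T \<open>convex P\<close> by (auto simp: normal_cone_def intro: face_of_Int_supporting_hyperplane_le)
  qed
  moreover have "x \<in> F" using x by (simp add: F_def)
  ultimately have "normal_cone P F \<in> normal_fan P" by (auto simp: normal_fan_def)
  then obtain G where G: "normal_cone P F = normal_cone M G" "G face_of M" "G \<noteq> {}"
    unfolding fan by (auto simp: normal_fan_def)
  then obtain q where q: "q \<in> G" "q \<in> M" using face_of_imp_subset by blast
  have "normal_cone P {x} \<subseteq> normal_cone P F" by (auto simp: normal_cone_def F_def)
  also have "\<dots> \<subseteq> normal_cone M {q}" unfolding G(1) using q by (auto simp: normal_cone_def)
  finally show thesis using that q by blast
qed

text \<open>Makes tightness visible to the normal fan: it says that an indicator functional is
  maximized at \<open>x\<close>.\<close>

lemma tight_iff_normal_cone: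
  assumes "\<And>y. y \<in> P \<Longrightarrow> weight y A \<le> f A" and "\<exists>y\<in>P. weight y A = f A" and "x \<in> P"
  shows "weight x A = f A \<longleftrightarrow> (\<chi> i. indicator A i) \<in> normal_cone P {x}"
proof -
  obtain z where "z \<in> P" "weight z A = f A" using assms(2) by blast
  then have "weight x A = f A \<longleftrightarrow> (\<forall>y\<in>P. weight y A \<le> weight x A)"
    using assms(1,3) by (metis order_antisym)
  then show ?thesis by (simp add: normal_cone_def weight_eq_inner)
qed

text \<open>A point \<open>q\<close> whose normal cone contains that of \<open>x\<close> maximizes
  every indicator functional that \<open>x\<close> maximizes.\<close>

lemma normal_fan_eq_tight:
  assumes fan: "normal_fan P = normal_fan M" and P: "base_polytope P f"
    and M: "\<And>A x. x \<in> M \<Longrightarrow> weight x A \<le> g A" "\<And>A. \<exists>x\<in>M. weight x A = g A"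
    and x: "x \<in> P"
  obtains q where "q \<in> M" "\<And>A. weight x A = f A \<Longrightarrow> weight q A = g A" "\<And>y. y \<in> M \<Longrightarrow> weight y UNIV = g UNIV"
proof -
  have "convex P" using base_polytopeD(1)[OF P] by (rule polytope_imp_convex)
  then obtain q where q: "q \<in> M" "normal_cone P {x} \<subseteq> normal_cone M {q}"
    using normal_fan_eq_point[OF fan _ x] by blast
  have tight: "weight q A = g A" if "weight x A = f A" for A
  proof -
    have "(\<chi> i. indicator A i) \<in> normal_cone P {x}"
      using tight_iff_normal_cone[of P A f x] that x base_polytopeD(2)[OF P] by blast
    then show ?thesis using tight_iff_normal_cone[of M A g q] M q by blast
  qed
  have "weight y UNIV = g UNIV" if y: "y \<in> M" for y
  proof -
    \<comment> \<open>Total weight is constant on \<open>P\<close>, so its negative is maximized at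
      \<open>x\<close> too. Hence \<open>q\<close> both minimizes and maximizes total weight on
      \<open>M\<close>.\<close>
    let ?w = "- (\<chi> i. 1) :: real ^ 'a"
    have w: "?w \<bullet> z = - weight z UNIV" for z by (simp add: inner_vec_def sum_negf)
    have "?w \<in> normal_cone P {x}"
      using base_polytopeD(3)[OF P] x unfolding normal_cone_def mem_Collect_eq w by simp
    then have "?w \<in> normal_cone M {q}" using q by blast
    then have "weight q UNIV \<le> weight y UNIV"
      using y unfolding normal_cone_def mem_Collect_eq w by simp
    moreover have "weight q UNIV = g UNIV" using tight base_polytopeD(3)[OF P x] by blast
    ultimately show ?thesis using M(1)[OF y, of UNIV] by linarith
  qed
  then show thesis using that[OF q(1)] tight by blast
qed

lemma normal_fan_eq_base_polytope:
  assumes fan: "normal_fan P = normal_fan M" and P: "base_polytope P f" and "polytope M"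
    and M: "\<And>A x. x \<in> M \<Longrightarrow> weight x A \<le> g A" "\<And>A. \<exists>x\<in>M. weight x A = g A"
  shows "base_polytope M g"
  unfolding base_polytope_def
proof (intro conjI ballI allI impI)
  show "polytope M" by fact
  show "weight y A \<le> g A" if "y \<in> M" for y A using M(1) that .
  show "weight y UNIV = g UNIV" if "y \<in> M" for y
  proof -
    obtain x where "x \<in> P" using base_polytope_nonempty[OF P] by blast
    then show ?thesis using normal_fan_eq_tight[OF fan P M] that by metis
  qed
  fix c :: "'a \<Rightarrow> nat" assume "ranking c"
  then obtain x where x: "x \<in> P" "\<And>t. weight x {i. c i < t} = f {i. c i < t}"
    using base_polytopeD(4)[OF P] by blast
  then show "\<exists>x\<in>M. \<forall>t. weight x {i. c i < t} = g {i. c i < t}"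
    using normal_fan_eq_tight[OF fan P M x(1)] by metis
qed

text \<open>A point of \<open>P\<close> tight on all four sets is matched by a point of
  \<open>M\<close> tight on the same four, where weights are modular.\<close>

lemma normal_fan_eq_tight_pairs:
  assumes fan: "normal_fan P = normal_fan M" and P: "base_polytope P f" and M: "base_polytope M g"
    and eq: "f A + f B = f (A \<inter> B) + f (A \<union> B)"
  shows "g A + g B = g (A \<inter> B) + g (A \<union> B)"
proof -
  obtain x where x: "x \<in> P" "weight x (A \<inter> B) = f (A \<inter> B)" "weight x A = f A" "weight x B = f B"
    "weight x (A \<union> B) = f (A \<union> B)"
    by (rule base_polytope_tight_point[OF P eq_refl[OF eq]])
  have "\<exists>x\<in>M. weight x A = g A" for A using base_polytope_attains[OF M] by blast
  then obtain q where "\<And>A. weight x A = f A \<Longrightarrow> weight q A = g A"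
    using normal_fan_eq_tight[OF fan P base_polytopeD(2)[OF M] _ x(1)] by metis
  then show ?thesis using weight_modular[of q A B] x by metis
qed

section \<open>Matroid polytopes\<close>

text \<open>For a matroid, \<open>m\<close> is the rank function. It is the support function of the
  polytope on indicator vectors, and its marginals are 0 or 1.\<close>

lemma matroid_polytope_weight:
  fixes \<B> :: "'n::finite set set"
  assumes "\<B> \<noteq> {}"
  defines "m \<equiv> \<lambda>A. Max ((\<lambda>B. card (A \<inter> B)) ` \<B>)"
  shows "polytope (matroid_polytope \<B>)"
    and "x \<in> matroid_polytope \<B> \<Longrightarrow> weight x A \<le> real (m A)"
    and "\<exists>x\<in>matroid_polytope \<B>. weight x A = real (m A)"
    and "m A \<le> m (insert i A)" and "m (insert i A) \<le> Suc (m A)"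
proof -
  have w: "weight (\<Sum>x\<in>B. axis x 1) A = real (card (A \<inter> B))" for A B :: "'n set"
  proof -
    have "(\<Sum>x\<in>B. axis x 1 :: real ^ 'n) $ i = (if i \<in> B then 1 else 0)" for i
      by (simp add: axis_def if_distrib sum.delta cong: if_cong)
    then show ?thesis by (simp add: sum.If_cases)
  qed
  have m: "card (A \<inter> B) \<le> m A" if "B \<in> \<B>" for A B
    unfolding m_def using that by (intro Max_ge) auto
  have m_attained: "\<exists>B\<in>\<B>. m A = card (A \<inter> B)" for A
  proof -
    have "m A \<in> (\<lambda>B. card (A \<inter> B)) ` \<B>" unfolding m_def using assms(1) by (intro Max_in) auto
    then show ?thesis by blast
  qed
  show "polytope (matroid_polytope \<B>)"
    by (simp add: matroid_polytope_def polytope_convex_hull)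
  show "weight x A \<le> real (m A)" if "x \<in> matroid_polytope \<B>"
  proof -
    have "matroid_polytope \<B> \<subseteq> {x. weight x A \<le> real (m A)}"
      unfolding matroid_polytope_def
    proof (rule hull_minimal)
      show "(\<lambda>B. \<Sum>x\<in>B. axis x 1) ` \<B> \<subseteq> {x. weight x A \<le> real (m A)}"
      proof clarify
        fix B assume "B \<in> \<B>"
        then show "weight (\<Sum>x\<in>B. axis x 1) A \<le> real (m A)" unfolding w using m[of B A] by simp
      qed
    qed (rule convex_weight_le)
    then show ?thesis using that by blast
  qed
  obtain B where B: "B \<in> \<B>" "m A = card (A \<inter> B)" using m_attained by blast
  then have "(\<Sum>x\<in>B. axis x 1) \<in> matroid_polytope \<B>"
    unfolding matroid_polytope_def by (intro hull_inc) blast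
  then show "\<exists>x\<in>matroid_polytope \<B>. weight x A = real (m A)" using w[of B A] B by metis
  have "card (A \<inter> B) \<le> card (insert i A \<inter> B)" by (rule card_mono) auto
  then show "m A \<le> m (insert i A)" using B m[of B "insert i A"] by simp
  obtain C where C: "C \<in> \<B>" "m (insert i A) = card (insert i A \<inter> C)" using m_attained by blast
  have "card (insert i A \<inter> C) \<le> card (insert i (A \<inter> C))" by (rule card_mono) auto
  also have "\<dots> \<le> Suc (card (A \<inter> C))" by (simp add: card_insert_le_m1 card_insert_if)
  finally show "m (insert i A) \<le> Suc (m A)" using C m[of C A] by simp
qed

text \<open>The marginals of a matroid rank function take at most two values.\<close>

lemma base_polytope_not_matroidal:
  fixes P :: "(real ^ 'n::finite) set"
  assumes P: "base_polytope P f" and ext: "extreme_submodular f"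
    and notin: "i \<notin> A" "i \<notin> B" "i \<notin> C"
    and distinct: "distinct [f (insert i A) - f A, f (insert i B) - f B, f (insert i C) - f C]"
  shows "\<not> (\<exists>\<B>. matroid_bases \<B> \<and> normally_equivalent P (matroid_polytope \<B>))"
proof
  assume "\<exists>\<B>. matroid_bases \<B> \<and> normally_equivalent P (matroid_polytope \<B>)"
  then obtain \<B> :: "'n set set" where \<B>: "\<B> \<noteq> {}"
    and fan: "normal_fan P = normal_fan (matroid_polytope \<B>)"
    by (auto simp: normally_equivalent_def matroid_bases_def)
  define m where "m A = Max ((\<lambda>B. card (A \<inter> B)) ` \<B>)" for A
  define g where "g A = real (m A)" for A
  note mat = matroid_polytope_weight[OF \<B>, folded m_def]
  have M: "base_polytope (matroid_polytope \<B>) g"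
    using normal_fan_eq_base_polytope[OF fan P mat(1)] mat(2,3) by (simp add: g_def[abs_def])
  have "g A + g B = g (A \<inter> B) + g (A \<union> B)" if "f A + f B = f (A \<inter> B) + f (A \<union> B)" for A B
    using normal_fan_eq_tight_pairs[OF fan P M that] .
  then obtain l t where lt: "g = (\<lambda>A. l * f A + weight t A)"
    using extreme_submodular_homothety[OF ext M] by blast
  have g_marginal: "g (insert i S) - g S = l * (f (insert i S) - f S) + t $ i" if "i \<notin> S" for S
    using that by (simp add: lt algebra_simps)
  have g01: "g (insert i S) - g S \<in> {0, 1}" for S
    using mat(4)[of S i] mat(5)[of i S] by (auto simp: g_def le_Suc_eq)
  show False
  proof (cases "l = 0")
    \<comment> \<open>Here \<open>g\<close> is modular, so all pairs are tight for it. Reading the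
      fan equality from \<open>M\<close> back to \<open>P\<close> makes the marginals of
      \<open>f\<close> at \<open>i\<close> constant.\<close>
    case True
    then have "f (insert i S) - f S = f {i} - f {}" if "i \<notin> S" for S
    proof -
      have "g {i} + g S = g ({i} \<inter> S) + g ({i} \<union> S)" using that True by (simp add: lt)
      then have "f {i} + f S = f ({i} \<inter> S) + f ({i} \<union> S)"
        by (rule normal_fan_eq_tight_pairs[OF fan[symmetric] M P])
      then show ?thesis using that by simp
    qed
    from this[OF notin(1)] this[OF notin(2)] show False using distinct by simp
  next
    case False
    \<comment> \<open>Solving the affine relation for the marginal of \<open>f\<close> leaves two
      candidates, one for each value of the marginal of \<open>g\<close>.\<close>
    have "f (insert i S) - f S \<in> {- t $ i / l, (1 - t $ i) / l}" if "i \<notin> S" for S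
    proof -
      have "f (insert i S) - f S = (g (insert i S) - g S - t $ i) / l"
        using g_marginal[OF that] False by simp
      then show ?thesis using g01[of S] by auto
    qed
    from this[OF notin(1)] this[OF notin(2)] this[OF notin(3)] show False
      using distinct unfolding distinct.simps by (elim insertE emptyE) simp_all
  qed
qed

section \<open>The number of vertices as an invariant of the face lattice\<close>

text \<open>Describes vertices by the order alone, as atoms of the face lattice. A nonempty face has
  an extreme point, whose singleton is a face of \<open>S\<close> by transitivity.\<close>

lemma singleton_face_iff_minimal:
  fixes S :: "'a::euclidean_space set"
  assumes "F face_of S" "polytope S"
  shows "(\<exists>x. F = {x}) \<longleftrightarrow> F \<noteq> {} \<and> (\<forall>F'. F' face_of S \<longrightarrow> F' \<subseteq> F \<longrightarrow> F' = {} \<or> F' = F)"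
proof
  assume r: "F \<noteq> {} \<and> (\<forall>F'. F' face_of S \<longrightarrow> F' \<subseteq> F \<longrightarrow> F' = {} \<or> F' = F)"
  have "polytope F" using assms face_of_polytope_polytope by blast
  then obtain x where "x extreme_point_of F"
    using extreme_point_exists_convex[of F] r polytope_imp_compact polytope_imp_convex by blast
  then have "{x} face_of F" by (simp add: face_of_singleton)
  then have "{x} face_of S" "{x} \<subseteq> F"
    using face_of_trans[OF _ assms(1)] face_of_imp_subset by auto
  then show "\<exists>x. F = {x}" using r by blast
qed auto

lemma card_singleton_faces:
  fixes S :: "'a::euclidean_space set"
  shows "card {F. F face_of S \<and> (\<exists>x. F = {x})} = card {x. x extreme_point_of S}"
proof -
  have "{F. F face_of S \<and> (\<exists>x. F = {x})} = (\<lambda>x. {x}) ` {x. x extreme_point_of S}"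
    by (auto simp: face_of_singleton)
  then show ?thesis by (simp add: card_image)
qed

lemma isomorphic_polytopes_card_extreme_points:
  fixes P :: "'a::euclidean_space set" and Q :: "'b::euclidean_space set"
  assumes "isomorphic_polytopes P Q" and "polytope P" "polytope Q"
  shows "card {x. x extreme_point_of P} = card {x. x extreme_point_of Q}"
proof -
  obtain f where f: "bij_betw f {F. F face_of P} {G. G face_of Q}"
    and mono: "\<And>F F'. F face_of P \<Longrightarrow> F' face_of P \<Longrightarrow> F \<subseteq> F' \<longleftrightarrow> f F \<subseteq> f F'"
    using assms(1) by (auto simp: isomorphic_polytopes_def)
  have face: "f F face_of Q" if "F face_of P" for F using bij_betw_apply[OF f, of F] that by simp
  have inj: "f F = f F' \<longleftrightarrow> F = F'" if "F face_of P" "F' face_of P" for F F'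
    using f that by (auto simp: bij_betw_def inj_on_def)
  have surj: "\<exists>F. F face_of P \<and> f F = G" if "G face_of Q" for G
  proof -
    have "G \<in> f ` {F. F face_of P}" using bij_betw_imp_surj_on[OF f] that by simp
    then show ?thesis by blast
  qed
  \<comment> \<open>An order isomorphism preserves the least element, here the empty face; the atoms
    then correspond as well.\<close>
  have f_empty: "f F = {} \<longleftrightarrow> F = {}" if "F face_of P" for F
  proof -
    obtain F0 where F0: "F0 face_of P" "f F0 = {}" using surj[OF empty_face_of] by blast
    have "F0 \<subseteq> {}" by (rule iffD2[OF mono[OF F0(1) empty_face_of]]) (simp add: F0)
    then have "f {} = {}" using F0 by simp
    then show ?thesis using inj[OF that empty_face_of] by simp
  qed
  have f_atom: "(\<exists>x. f F = {x}) \<longleftrightarrow> (\<exists>x. F = {x})" if F: "F face_of P" for F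
  proof -
    have "(\<forall>G. G face_of Q \<longrightarrow> G \<subseteq> f F \<longrightarrow> G = {} \<or> G = f F) \<longleftrightarrow>
      (\<forall>F'. F' face_of P \<longrightarrow> F' \<subseteq> F \<longrightarrow> F' = {} \<or> F' = F)" (is "?L \<longleftrightarrow> ?R")
    proof
      assume L: ?L
      show ?R
      proof (intro allI impI)
        fix F' assume F': "F' face_of P" "F' \<subseteq> F"
        then have "f F' \<subseteq> f F" using mono[OF F'(1) F] by simp
        then have "f F' = {} \<or> f F' = f F" using L face[OF F'(1)] by blast
        then show "F' = {} \<or> F' = F" using f_empty[OF F'(1)] inj[OF F'(1) F] by simp
      qed
    next
      assume R: ?R
      show ?L
      proof (intro allI impI)
        fix G assume G: "G face_of Q" "G \<subseteq> f F"
        then obtain F' where F': "F' face_of P" "f F' = G" using surj by blast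
        then have "F' \<subseteq> F" using mono[OF F'(1) F] G(2) by simp
        then have "F' = {} \<or> F' = F" using R F'(1) by blast
        then show "G = {} \<or> G = f F" using f_empty[OF F'(1)] F'(2) by blast
      qed
    qed
    then show ?thesis
      unfolding singleton_face_iff_minimal[OF F assms(2)]
        singleton_face_iff_minimal[OF face[OF F] assms(3)]
      using f_empty[OF F] by simp
  qed
  let ?A = "{F. F face_of P \<and> (\<exists>x. F = {x})}" and ?B = "{G. G face_of Q \<and> (\<exists>x. G = {x})}"
  have "f ` ?A = ?B"
  proof (intro subset_antisym subsetI)
    fix G assume "G \<in> ?B"
    then obtain F where "F face_of P" "f F = G" "\<exists>x. f F = {x}" using surj by blast
    then show "G \<in> f ` ?A" using f_atom by blast
  next
    fix G assume "G \<in> f ` ?A"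
    then obtain F where "F face_of P" "\<exists>x. F = {x}" "G = f F" by blast
    then show "G \<in> ?B" using f_atom face by blast
  qed
  moreover have "inj_on f ?A" using f by (auto simp: bij_betw_def intro: inj_on_subset)
  ultimately have "card ?B = card ?A" using card_image[of f ?A] by simp
  then show ?thesis unfolding card_singleton_faces by (rule sym)
qed

section \<open>Slabs of the cube\<close>

text \<open>An open halfspace contains all the other points but not \<open>v\<close>, so
  \<open>v\<close> is outside their convex hull.\<close>

lemma extreme_points_convex_hull_exposed:
  fixes V :: "'a::euclidean_space set"
  assumes "finite V" and exposed: "\<And>v. v \<in> V \<Longrightarrow> \<exists>w. \<forall>u\<in>V - {v}. w \<bullet> u < w \<bullet> v"
  shows "{x. x extreme_point_of (convex hull V)} = V"
proof -
  have "v \<notin> convex hull (V - {v})" if v: "v \<in> V" for v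
  proof
    assume h: "v \<in> convex hull (V - {v})"
    obtain w where w: "\<And>u. u \<in> V - {v} \<Longrightarrow> w \<bullet> u < w \<bullet> v" using exposed[OF v] by blast
    have "convex hull (V - {v}) \<subseteq> {u. w \<bullet> u < w \<bullet> v}"
      by (rule hull_minimal) (use w in \<open>auto simp: convex_halfspace_lt\<close>)
    then show False using h by blast
  qed
  then show ?thesis
    using extreme_point_of_convex_hull_convex_independent[of V] finite_imp_compact[OF assms(1)] by blast
qed

text \<open>One element \<open>e\<close> can be left out: its marginals are determined by the remaining ones.\<close>

lemma extreme_submodularI:
  fixes f :: "'n::finite set \<Rightarrow> real"
  assumes "f {} = 0"
    and ext: "\<And>g :: 'n set \<Rightarrow> real. g {} = 0 \<Longrightarrow> (\<And>A B. g (A \<inter> B) + g (A \<union> B) \<le> g A + g B) \<Longrightarrow>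
      (\<And>A B. f A + f B = f (A \<inter> B) + f (A \<union> B) \<Longrightarrow> g A + g B = g (A \<inter> B) + g (A \<union> B)) \<Longrightarrow>
      (\<And>S T i. S \<subseteq> T \<Longrightarrow> i \<notin> T \<Longrightarrow> f (insert i S) - f S = f (insert i T) - f T \<Longrightarrow>
         g (insert i S) - g S = g (insert i T) - g T) \<Longrightarrow>
      \<exists>l\<ge>0. \<exists>z. \<forall>i S. i \<noteq> e \<longrightarrow> i \<notin> S \<longrightarrow>
         g (insert i S) - g S = l * (f (insert i S) - f S) + z i"
  shows "extreme_submodular f"
  unfolding extreme_submodular_def
proof (intro allI impI)
  fix g :: "'n set \<Rightarrow> real"
  assume g: "g {} = 0" "\<forall>A B. g (A \<inter> B) + g (A \<union> B) \<le> g A + g B"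
    "\<forall>A B. f A + f B = f (A \<inter> B) + f (A \<union> B) \<longrightarrow> g A + g B = g (A \<inter> B) + g (A \<union> B)"
  have "g (insert i S) - g S = g (insert i T) - g T"
    if "S \<subseteq> T" "i \<notin> T" "f (insert i S) - f S = f (insert i T) - f T" for S T i
  proof -
    \<comment> \<open>Equal marginals over nested \<open>S\<close> and \<open>T\<close> amount to
      tightness of the pair \<open>insert i S\<close>, \<open>T\<close>.\<close>
    have sets: "insert i S \<inter> T = S" "insert i S \<union> T = insert i T" using that by auto
    have "f (insert i S) + f T = f (insert i S \<inter> T) + f (insert i S \<union> T)"
      unfolding sets using that(3) by simp
    then have "g (insert i S) + g T = g (insert i S \<inter> T) + g (insert i S \<union> T)" using g(3) by blast
    then show ?thesis unfolding sets by simp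
  qed
  then obtain l z where l: "l \<ge> 0"
    and z: "\<And>i S. i \<noteq> e \<Longrightarrow> i \<notin> S \<Longrightarrow> g (insert i S) - g S = l * (f (insert i S) - f S) + z i"
    using ext[of g] g by blast
  \<comment> \<open>The coordinate at \<open>e\<close> makes the formula hold at \<open>{e}\<close>.
    Starting from \<open>{}\<close> or \<open>{e}\<close>, the other elements are then added one by
    one.\<close>
  define t :: "real ^ 'n" where "t = (\<chi> i. if i = e then g {e} - l * f {e} else z i)"
  have grow: "g (A \<union> B) = l * f (A \<union> B) + weight t (A \<union> B)"
    if "finite B" and "g A = l * f A + weight t A" "e \<notin> B" "A \<inter> B = {}" for A B
    using that
  proof (induction B rule: finite_induct)
    case empty then show ?case by simp
  next
    case (insert i B)
    then have "i \<noteq> e" "i \<notin> A \<union> B" by auto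
    from z[OF this] have "g (insert i (A \<union> B)) = g (A \<union> B) + l * (f (insert i (A \<union> B)) - f (A \<union> B)) + z i"
      by simp
    moreover have "weight t (insert i (A \<union> B)) = z i + weight t (A \<union> B)"
      using \<open>i \<noteq> e\<close> \<open>i \<notin> A \<union> B\<close> by (simp add: t_def)
    ultimately show ?case using insert by (simp add: algebra_simps)
  qed
  have "g A = l * f A + weight t A" for A
  proof (cases "e \<in> A")
    case True
    then show ?thesis using grow[of "A - {e}" "{e}"] by (simp add: t_def insert_absorb)
  next
    case False
    then show ?thesis using grow[of A "{}"] g(1) assms(1) by simp
  qed
  then show "\<exists>l\<ge>0. \<exists>t. \<forall>A. g A = l * f A + weight t A" using l by blast
qed

text \<open>The slab \<open>{x \<in> [0,1]\<^sup>N\<^sup>-\<^sup>1. a \<le> \<Sum>i. x\<^sub>i \<le> b}\<close> of the cube, lifted to the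
  hyperplane of vectors with coordinate sum zero by means of the coordinate \<open>e\<close>.\<close>

definition slab_point :: "'n::finite \<Rightarrow> 'n set \<Rightarrow> real ^ 'n" where
  "slab_point e S = (\<chi> i. if i = e then - real (card S) else if i \<in> S then 1 else 0)"

definition slab_sets :: "'n::finite \<Rightarrow> nat \<Rightarrow> nat \<Rightarrow> 'n set set" where
  "slab_sets e a b = {S. e \<notin> S \<and> a \<le> card S \<and> card S \<le> b}"

definition cube_slab :: "'n::finite \<Rightarrow> nat \<Rightarrow> nat \<Rightarrow> (real ^ 'n) set" where
  "cube_slab e a b = convex hull (slab_point e ` slab_sets e a b)"

text \<open>The support function of the slab on indicator vectors. If \<open>e\<close> is in
  \<open>A\<close>, the weight is minus the number of chosen elements outside \<open>A\<close>, and
  at least \<open>a - card (A - {e})\<close> of them are forced.\<close>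

definition slab_fun :: "'n::finite \<Rightarrow> nat \<Rightarrow> nat \<Rightarrow> 'n set \<Rightarrow> real" where
  "slab_fun e a b A =
     (if e \<in> A then real (min (card (A - {e})) a) - real a else real (min (card A) b))"

lemma weight_slab_point:
  assumes "e \<notin> S"
  shows "weight (slab_point e S) A = (if e \<in> A then - real (card (S - A)) else real (card (A \<inter> S)))"
proof -
  have *: "weight (slab_point e S) B = real (card (B \<inter> S))" if "e \<notin> B" for B
  proof -
    have "weight (slab_point e S) B = (\<Sum>i\<in>B. if i \<in> S then 1 else 0)"
      using that by (intro sum.cong) (auto simp: slab_point_def)
    then show ?thesis by (simp add: sum.If_cases)
  qed
  show ?thesis
  proof (cases "e \<in> A")
    case True
    have "weight (slab_point e S) A = slab_point e S $ e + weight (slab_point e S) (A - {e})"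
      using True by (simp add: sum.remove)
    also have "\<dots> = real (card ((A - {e}) \<inter> S)) - real (card S)"
      by (subst *) (simp_all add: slab_point_def)
    also have "(A - {e}) \<inter> S = S \<inter> A" using assms by auto
    also have "card S = card (S \<inter> A) + card (S - A)" by (rule card_Int_Diff) simp
    finally show ?thesis using True by simp
  qed (simp add: *)
qed

lemma base_polytope_cube_slab:
  fixes e :: "'n::finite"
  assumes "a \<le> b" "b < CARD('n)"
  shows "base_polytope (cube_slab e a b) (slab_fun e a b)"
  unfolding cube_slab_def
proof (rule base_polytope_convex_hull)
  show "finite (slab_point e ` slab_sets e a b)" by simp
next
  fix x A assume "x \<in> slab_point e ` slab_sets e a b"
  then obtain S where S: "e \<notin> S" "a \<le> card S" "card S \<le> b" "x = slab_point e S"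
    by (auto simp: slab_sets_def)
  show "weight x UNIV = slab_fun e a b UNIV"
    using S assms by (simp add: weight_slab_point slab_fun_def)
  show "weight x A \<le> slab_fun e a b A"
  proof (cases "e \<in> A")
    case True
    have "S \<subseteq> (A - {e}) \<union> (S - A)" using S(1) by auto
    then have "card S \<le> card ((A - {e}) \<union> (S - A))" by (intro card_mono) auto
    also have "\<dots> \<le> card (A - {e}) + card (S - A)" by (rule card_Un_le)
    finally show ?thesis using True S by (simp add: weight_slab_point slab_fun_def)
  next
    case False
    have "card (A \<inter> S) \<le> card A" "card (A \<inter> S) \<le> card S" by (auto intro: card_mono)
    then show ?thesis using False S by (simp add: weight_slab_point slab_fun_def)
  qed
next
  fix c :: "'n \<Rightarrow> nat" assume c: "ranking c"
  let ?N = "CARD('n)" and ?L = "\<lambda>t. {i. c i < t}"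
  \<comment> \<open>The optimal set for \<open>c\<close> takes elements preceding \<open>e\<close>
    while \<open>b\<close> permits, and later ones only to reach \<open>a\<close>. Its size is
    therefore the position of \<open>e\<close> clamped to the interval from \<open>a\<close> to
    \<open>b\<close>.\<close>
  define s where "s = (if c e < a then a else if b < c e then b else c e)"
  \<comment> \<open>The length of the initial segment with \<open>s\<close> elements besides
    \<open>e\<close>: one more once \<open>e\<close> itself is included.\<close>
  define u where "u = (if s \<le> c e then s else Suc s)"
  have s: "a \<le> s" "s \<le> b" using assms(1) by (auto simp: s_def)
  have "u \<le> ?N" using s assms(2) by (simp add: u_def)
  define S where "S = ?L u - {e}"
  have cardL: "card (?L t) = t" if "t \<le> ?N" for t using rankingD(3)[OF c that] .
  have "card S = s"
  proof (cases "s \<le> c e")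
    case True
    then have "S = ?L s" by (auto simp: S_def u_def)
    then show ?thesis using cardL[of s] s assms(2) by simp
  next
    case False
    then have "card S = card (?L (Suc s)) - 1" by (simp add: S_def u_def)
    then show ?thesis using cardL[of "Suc s"] s assms(2) by simp
  qed
  then have S: "S \<in> slab_sets e a b" using s by (simp add: slab_sets_def S_def)
  have eS: "e \<notin> S" by (simp add: S_def)
  have tight: "weight (slab_point e S) (?L t) = slab_fun e a b (?L t)" if t: "t \<le> ?N" for t
  proof (cases "t \<le> c e")
    case True
    then have "?L t \<inter> S = ?L (min t u)" by (auto simp: S_def)
    then have "card (?L t \<inter> S) = min t u" using cardL[of "min t u"] t by simp
    moreover have "min t u = min t b" using True s by (auto simp: u_def s_def split: if_splits)
    ultimately show ?thesis using True cardL[OF t] by (simp add: weight_slab_point[OF eS] slab_fun_def)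
  next
    case False
    then have "S - ?L t = ?L u - ?L t" by (auto simp: S_def)
    moreover have "card (?L u - ?L t) = u - t"
    proof (cases "t \<le> u")
      case True
      then have "?L t \<subseteq> ?L u" by auto
      then show ?thesis using cardL[OF t] cardL[OF \<open>u \<le> ?N\<close>] by (simp add: card_Diff_subset)
    next
      case False
      then have "?L u - ?L t = {}" by auto
      then show ?thesis using False by simp
    qed
    moreover have "card (?L t - {e}) = t - 1" using False cardL[OF t] by simp
    moreover have "- real (u - t) = real (min (t - 1) a) - real a"
      using False s by (auto simp: u_def s_def split: if_splits)
    ultimately show ?thesis using False by (simp add: weight_slab_point[OF eS] slab_fun_def)
  qed
  have "weight (slab_point e S) (?L t) = slab_fun e a b (?L t)" for t
  proof (cases "t \<le> ?N")
    case False
    then have "?L t = ?L ?N" using rankingD(2)[OF c] by (auto simp: not_le intro: less_trans)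
    then show ?thesis using tight[of ?N] by simp
  qed (rule tight)
  then show "\<exists>x\<in>slab_point e ` slab_sets e a b. \<forall>t. weight x (?L t) = slab_fun e a b (?L t)"
    using S by blast
qed

lemma slab_fun_marginal:
  assumes "i \<noteq> e" "i \<notin> S"
  shows "slab_fun e a b (insert i S) - slab_fun e a b S =
    (if (if e \<in> S then card (S - {e}) < a else card S < b) then 1 else 0)"
proof -
  have "insert i S - {e} = insert i (S - {e})" using assms by auto
  then show ?thesis using assms by (auto simp: slab_fun_def)
qed

text \<open>The marginals of \<open>f\<close> away from \<open>e\<close> are 0 or 1, and those of
  \<open>g\<close> depend only on \<open>i\<close> and on this value. It remains to see that the
  difference of the two values for \<open>g\<close> is the same for all \<open>i\<close>.\<close>

lemma extreme_slab_fun: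
  fixes e :: "'n::finite"
  assumes "a < b" "Suc b < CARD('n)"
  shows "extreme_submodular (slab_fun e a b)" (is "extreme_submodular ?f")
proof (rule extreme_submodularI[where e = e])
  show "?f {} = 0" by (simp add: slab_fun_def)
  fix g :: "'n set \<Rightarrow> real"
  assume sub: "\<And>A B. g (A \<inter> B) + g (A \<union> B) \<le> g A + g B"
    and marg: "\<And>S T i. S \<subseteq> T \<Longrightarrow> i \<notin> T \<Longrightarrow> ?f (insert i S) - ?f S = ?f (insert i T) - ?f T \<Longrightarrow>
         g (insert i S) - g S = g (insert i T) - g T"
  \<comment> \<open>\<open>x i\<close> and \<open>y i\<close> are the marginals of \<open>g\<close>
    where that of \<open>f\<close> is 1 and 0, read off at the empty set and at the complement of
    \<open>i\<close>.\<close>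
  define x where "x i = g {i} - g {}" for i
  define y where "y i = g UNIV - g (UNIV - {i})" for i
  have f01: "?f (insert i S) - ?f S \<in> {0, 1}" if "i \<noteq> e" "i \<notin> S" for i S
    using slab_fun_marginal[OF that] by simp
  have gx: "g (insert i S) - g S = x i" if "i \<noteq> e" "i \<notin> S" "?f (insert i S) - ?f S = 1" for i S
    using marg[of "{}" S i] that slab_fun_marginal[of i e "{}" a b] assms by (simp add: x_def)
  have gy: "g (insert i S) - g S = y i" if "i \<noteq> e" "i \<notin> S" "?f (insert i S) - ?f S = 0" for i S
  proof -
    have "card (UNIV - {i} - {e}) = CARD('n) - 2" using that by (simp add: card_Diff_subset)
    then have "?f (insert i (UNIV - {i})) - ?f (UNIV - {i}) = 0"
      using slab_fun_marginal[of i e "UNIV - {i}" a b] that assms by simp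
    then show ?thesis using marg[of S "UNIV - {i}" i] that by (auto simp: y_def insert_absorb)
  qed
  \<comment> \<open>Over a set of size \<open>b - 1\<close> without \<open>e\<close>, the first of
    \<open>i\<close>, \<open>j\<close> to enter has marginal 1 and the second 0. The two orders of
    insertion give the equation, submodularity the inequality.\<close>
  have exch: "x i + y j = x j + y i \<and> y i \<le> x i" if ij: "i \<noteq> e" "j \<noteq> e" "i \<noteq> j" for i j
  proof -
    have "card (UNIV - {e, i, j}) = CARD('n) - 3" using ij by (simp add: card_Diff_subset)
    then have "b - 1 \<le> card (UNIV - {e, i, j})" using assms by linarith
    then obtain S where S: "S \<subseteq> UNIV - {e, i, j}" "card S = b - 1"
      by (meson obtain_subset_with_card_n)
    have ns: "e \<notin> S" "i \<notin> S" "j \<notin> S" using S by auto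
    have "g (insert i S) - g S = x i" "g (insert j S) - g S = x j"
      using gx[of i S] gx[of j S] slab_fun_marginal[of i e S a b] slab_fun_marginal[of j e S a b]
        S assms ij ns by simp_all
    moreover have "g (insert j (insert i S)) - g (insert i S) = y j"
      "g (insert i (insert j S)) - g (insert j S) = y i"
      using gy[of j "insert i S"] gy[of i "insert j S"] slab_fun_marginal[of j e "insert i S" a b]
        slab_fun_marginal[of i e "insert j S" a b] S assms ij ns by simp_all
    moreover have "insert i S \<inter> insert j S = S" "insert i S \<union> insert j S = insert j (insert i S)"
      using ij ns by auto
    ultimately show ?thesis using sub[of "insert i S" "insert j S"] by (simp add: insert_commute)
  qed
  have two: "\<exists>j. j \<noteq> e \<and> j \<noteq> i" for i
  proof -
    have "card {e, i} < CARD('n)" using assms by (auto simp: card_insert_if)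
    then have "{e, i} \<noteq> UNIV" by auto
    then show ?thesis by blast
  qed
  obtain k where k: "k \<noteq> e" using two by blast
  obtain k' where k': "k' \<noteq> e" "k' \<noteq> k" using two by blast
  define l where "l = x k - y k"
  have xy: "x i = l + y i" if "i \<noteq> e" for i
    using exch[of i k] that k by (cases "i = k") (auto simp: l_def)
  show "\<exists>l\<ge>0. \<exists>z. \<forall>i S. i \<noteq> e \<longrightarrow> i \<notin> S \<longrightarrow> g (insert i S) - g S = l * (?f (insert i S) - ?f S) + z i"
  proof (intro exI conjI allI impI)
    show "l \<ge> 0" using exch[of k k'] k k' by (simp add: l_def)
    fix i S assume iS: "i \<noteq> e" "i \<notin> (S :: 'n set)"
    from f01[OF iS] consider "?f (insert i S) - ?f S = 0" | "?f (insert i S) - ?f S = 1" by auto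
    then show "g (insert i S) - g S = l * (?f (insert i S) - ?f S) + y i"
      by cases (simp_all add: gx[OF iS] gy[OF iS] xy[OF iS(1)])
  qed
qed

text \<open>The marginals of \<open>e\<close> over sets of sizes \<open>a\<close>,
  \<open>a + 1\<close>, \<open>a + 2\<close> avoiding \<open>e\<close> are minus these
  sizes.\<close>

lemma cube_slab_not_matroidal:
  fixes e :: "'n::finite"
  assumes "a + 2 \<le> b" "Suc b < CARD('n)"
  shows "\<not> (\<exists>\<B>. matroid_bases \<B> \<and> normally_equivalent (cube_slab e a b) (matroid_polytope \<B>))"
proof -
  have "\<exists>A. e \<notin> A \<and> card A = k" if "k \<le> b" for k
  proof -
    have "k \<le> card (UNIV - {e})" using that assms by (simp add: card_Diff_subset)
    then obtain A where "A \<subseteq> UNIV - {e}" "card A = k" by (meson obtain_subset_with_card_n)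
    then show ?thesis by blast
  qed
  from this[of a] this[of "Suc a"] this[of "a + 2"] assms(1)
  obtain A B C where ABC: "e \<notin> A" "card A = a" "e \<notin> B" "card B = Suc a" "e \<notin> C" "card C = a + 2"
    by auto
  have P: "base_polytope (cube_slab e a b) (slab_fun e a b)"
    using assms by (intro base_polytope_cube_slab) auto
  have E: "extreme_submodular (slab_fun e a b)" using assms by (intro extreme_slab_fun) auto
  show ?thesis
    by (rule base_polytope_not_matroidal[OF P E ABC(1,3,5)])
      (use ABC assms in \<open>simp add: slab_fun_def\<close>)
qed

lemma card_extreme_points_cube_slab:
  fixes e :: "'n::finite"
  shows "card {x. x extreme_point_of (cube_slab e a b)} = (\<Sum>k=a..b. (CARD('n) - 1) choose k)"
proof -
  have sep: "\<exists>w. \<forall>T. e \<notin> T \<longrightarrow> T \<noteq> S \<longrightarrow> w \<bullet> slab_point e T < w \<bullet> slab_point e S" if S: "e \<notin> S" for S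
  proof (intro exI allI impI)
    \<comment> \<open>The direction is 1 on \<open>S\<close>, 0 at \<open>e\<close> and -1
      elsewhere; among the lifted cube vertices only that of \<open>S\<close> maximizes it.\<close>
    let ?w = "(\<chi> i. indicator S i) - (\<chi> i. indicator (- insert e S) i) :: real ^ 'n"
    have w: "?w \<bullet> slab_point e T = real (card (S \<inter> T)) - real (card (- insert e S \<inter> T))" if "e \<notin> T" for T
      using that S by (simp add: inner_diff_left weight_slab_point flip: weight_eq_inner)
    fix T assume T: "e \<notin> T" "T \<noteq> S"
    have "card (S \<inter> T) < card S \<or> 0 < card (- insert e S \<inter> T)"
    proof (cases "T \<subseteq> S")
      case True
      then have "S \<inter> T \<subset> S" using T by blast
      then show ?thesis by (simp add: psubset_card_mono)
    next
      case False
      then obtain k where "k \<in> T" "k \<notin> S" by blast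
      then have "k \<in> - insert e S \<inter> T" using T(1) by auto
      then have "0 < card (- insert e S \<inter> T)" by (auto simp: card_gt_0_iff)
      then show ?thesis ..
    qed
    moreover have "card (S \<inter> T) \<le> card S" by (rule card_mono) auto
    moreover have "- insert e S \<inter> S = {}" by auto
    ultimately show "?w \<bullet> slab_point e T < ?w \<bullet> slab_point e S"
      by (auto simp: w[OF T(1)] w[OF S])
  qed
  have inj: "inj_on (slab_point e) (slab_sets e a b)"
  proof (rule inj_onI)
    fix S T assume "S \<in> slab_sets e a b" "T \<in> slab_sets e a b" "slab_point e S = slab_point e T"
    then show "S = T" using sep[of S] by (auto simp: slab_sets_def)
  qed
  have "{x. x extreme_point_of (cube_slab e a b)} = slab_point e ` slab_sets e a b"
    unfolding cube_slab_def
  proof (rule extreme_points_convex_hull_exposed)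
    fix v assume "v \<in> slab_point e ` slab_sets e a b"
    then obtain S where S: "e \<notin> S" "v = slab_point e S" by (auto simp: slab_sets_def)
    obtain w where "\<And>T. e \<notin> T \<Longrightarrow> T \<noteq> S \<Longrightarrow> w \<bullet> slab_point e T < w \<bullet> slab_point e S"
      using sep[OF S(1)] by blast
    then have "\<forall>u\<in>slab_point e ` slab_sets e a b - {v}. w \<bullet> u < w \<bullet> v"
      using S(2) by (auto simp: slab_sets_def)
    then show "\<exists>w. \<forall>u\<in>slab_point e ` slab_sets e a b - {v}. w \<bullet> u < w \<bullet> v" by blast
  qed simp
  then have "card {x. x extreme_point_of (cube_slab e a b)} = card (slab_sets e a b)"
    using card_image[OF inj] by simp
  also have "slab_sets e a b = (\<Union>k\<in>{a..b}. {S. S \<subseteq> UNIV - {e} \<and> card S = k})"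
    by (auto simp: slab_sets_def)
  also have "card \<dots> = (\<Sum>k=a..b. card {S. S \<subseteq> UNIV - {e} \<and> card S = k})"
    by (rule card_UN_disjoint) auto
  also have "\<dots> = (\<Sum>k=a..b. (CARD('n) - 1) choose k)"
    by (intro sum.cong refl) (subst n_subsets, simp_all add: card_Diff_subset)
  finally show ?thesis .
qed

section \<open>Comparison of vertex counts\<close>

text \<open>The gap of 2 matters because changing \<open>a\<close> between 0 and 1 alters a count by
  1. By Pascal's rule the binomial coefficient at \<open>b'\<close> is a sum of two positive
  numbers.\<close>

lemma sum_binomial_less:
  assumes "b < b'" "b' < n" "1 < n"
  shows "(\<Sum>k=0..b. n choose k) + 2 \<le> (\<Sum>k=0..b'. n choose k)"
proof -
  obtain m where m: "n = Suc m" using assms(3) by (cases n) auto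
  obtain j where j: "b' = Suc j" using assms(1) by (cases b') auto
  have "0 < m choose j" "0 < m choose Suc j" using assms m j by (simp_all add: zero_less_binomial_iff)
  then have "2 \<le> n choose b'" unfolding m j binomial_Suc_Suc by linarith
  have "(\<Sum>k=0..b. n choose k) + (n choose b') = (\<Sum>k\<in>insert b' {0..b}. n choose k)"
    using assms by simp
  also have "\<dots> \<le> (\<Sum>k=0..b'. n choose k)" by (rule sum_mono2) (use assms in auto)
  finally show ?thesis using \<open>2 \<le> n choose b'\<close> by simp
qed

lemma sum_binomial_from_1: "(\<Sum>k=0..b. n choose k) = Suc (\<Sum>k=1..b. n choose k)"
  using sum.atLeast_Suc_atMost[of 0 b "\<lambda>k. n choose k"] by simp

lemma slab_count_inj:
  assumes "a \<le> 1" "b < n" "a' \<le> 1" "b' < n" "1 < n"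
    and eq: "(\<Sum>k=a..b. n choose k) = (\<Sum>k=a'..b'. n choose k)"
  shows "a = a' \<and> b = b'"
proof -
  have c: "(\<Sum>k=0..b. n choose k) = (\<Sum>k=a..b. n choose k) + a" if "a \<le> 1" for a b
  proof -
    have "a = 0 \<or> a = 1" using that by linarith
    then show ?thesis using sum_binomial_from_1[of n b] by (elim disjE) simp_all
  qed
  have W: "(\<Sum>k=0..b. n choose k) + a' = (\<Sum>k=0..b'. n choose k) + a"
    using c[OF assms(1), of b] c[OF assms(3), of b'] eq by linarith
  have "\<not> b < b'"
  proof
    assume "b < b'"
    from sum_binomial_less[OF this assms(4,5)] show False using W assms(1,3) by linarith
  qed
  moreover have "\<not> b' < b"
  proof
    assume "b' < b"
    from sum_binomial_less[OF this assms(2,5)] show False using W assms(1,3) by linarith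
  qed
  ultimately show ?thesis using W by simp
qed

text \<open>The counts are 7 for \<open>n = 3\<close> and 11, 15, 14 for \<open>n = 4\<close>. From
  \<open>n = 5\<close> on, the terms for 1 and 2 alone add up to at least 15.\<close>

lemma slab_count_neq_13:
  assumes "a \<le> 1" "a + 2 \<le> b" "b < n"
  shows "(\<Sum>k=a..b. n choose k) \<noteq> 13"
proof -
  consider "n = 3" | "n = 4" | "n \<ge> 5" using assms by linarith
  then show ?thesis
  proof cases
    case 1
    then have "a = 0" "b = 2" using assms by auto
    then show ?thesis using 1 by (simp add: numeral_eq_Suc)
  next
    case 2
    then consider "a = 0" "b = 2" | "a = 0" "b = 3" | "a = 1" "b = 3" using assms by linarith
    then show ?thesis using 2 by cases (simp_all add: numeral_eq_Suc)
  next
    case 3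
    have "5 * 4 div 2 \<le> n * (n - 1) div 2" using 3 by (intro div_le_mono mult_le_mono) auto
    then have "15 \<le> n + (n choose 2)" using 3 by (simp add: choose_two)
    also have "\<dots> = (\<Sum>k\<in>{1, 2}. n choose k)" by simp
    also have "\<dots> \<le> (\<Sum>k=a..b. n choose k)" by (rule sum_mono2) (use assms in auto)
    finally show ?thesis by simp
  qed
qed

section \<open>The stacked root polytope\<close>

text \<open>The root polytope of \<open>A\<^sub>3\<close> (a cuboctahedron) with a pyramid over one square face, whose
  apex is placed so that the triangles adjacent to that square become rhombi.\<close>

definition root_vector :: "'n::finite \<Rightarrow> 'n \<Rightarrow> real ^ 'n" where
  "root_vector i j = axis i 1 - axis j 1"

definition apex :: "'n::finite \<Rightarrow> 'n \<Rightarrow> 'n \<Rightarrow> 'n \<Rightarrow> real ^ 'n" where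
  "apex p q r s = root_vector r p + root_vector s q"

definition stacked_vertices :: "'n::finite \<Rightarrow> 'n \<Rightarrow> 'n \<Rightarrow> 'n \<Rightarrow> (real ^ 'n) set" where
  "stacked_vertices p q r s =
     insert (apex p q r s) {root_vector i j | i j. i \<in> {p, q, r, s} \<and> j \<in> {p, q, r, s} \<and> i \<noteq> j}"

text \<open>The support function on indicator vectors. The roots alone give 1 on every proper
  nonempty trace on \<open>{p, q, r, s}\<close>; the apex raises only the trace
  \<open>{r, s}\<close>.\<close>

definition stacked_fun :: "'n::finite \<Rightarrow> 'n \<Rightarrow> 'n \<Rightarrow> 'n \<Rightarrow> 'n set \<Rightarrow> real" where
  "stacked_fun p q r s A =
     (if {p, q, r, s} \<inter> A = {} \<or> {p, q, r, s} \<subseteq> A then 0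
      else if {p, q, r, s} \<inter> A = {r, s} then 2 else 1)"

lemma weight_root: "weight (root_vector i j) A = of_bool (i \<in> A) - of_bool (j \<in> A)"
proof -
  have "weight (axis i 1) A = of_bool (i \<in> A)" for i
    by (simp add: axis_def)
  then show ?thesis by (simp add: root_vector_def sum_subtractf)
qed

lemma root_eqD:
  assumes "i \<noteq> j" "root_vector i j = root_vector a b"
  shows "i = a \<and> j = b"
proof -
  have "weight (root_vector a b) {i} = 1" "weight (root_vector a b) {j} = - 1"
    using weight_root[of i j "{i}"] weight_root[of i j "{j}"] assms by simp_all
  then show ?thesis unfolding weight_root by (simp_all add: of_bool_def split: if_splits)
qed

lemma weight_apex:
  "weight (apex p q r s) A =
     of_bool (r \<in> A) + of_bool (s \<in> A) - of_bool (p \<in> A) - of_bool (q \<in> A)"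
proof -
  have "weight (apex p q r s) A = weight (root_vector r p) A + weight (root_vector s q) A"
    by (simp add: apex_def sum.distrib)
  then show ?thesis by (simp only: weight_root)
qed

lemma inner_root: "w \<bullet> root_vector i j = w $ i - w $ j"
  by (simp add: root_vector_def inner_diff_right inner_axis)

lemma finite_stacked_vertices: "finite (stacked_vertices p q r s)"
proof -
  have "{root_vector i j | i j. i \<in> {p, q, r, s} \<and> j \<in> {p, q, r, s} \<and> i \<noteq> j} \<subseteq>
    (\<lambda>(i, j). root_vector i j) ` ({p, q, r, s} \<times> {p, q, r, s})" by auto
  then show ?thesis unfolding stacked_vertices_def by (auto intro: finite_subset)
qed

context
  fixes p q r s :: "'n::finite"
  assumes distinct: "distinct [p, q, r, s]"
begin

lemma pqrs: "p \<noteq> q" "p \<noteq> r" "p \<noteq> s" "q \<noteq> r" "q \<noteq> s" "r \<noteq> s"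
  "q \<noteq> p" "r \<noteq> p" "s \<noteq> p" "r \<noteq> q" "s \<noteq> q" "s \<noteq> r"
  using distinct by auto

lemma stacked_fun_eq:
  "stacked_fun p q r s A =
     (if (p \<notin> A \<and> q \<notin> A \<and> r \<notin> A \<and> s \<notin> A) \<or> (p \<in> A \<and> q \<in> A \<and> r \<in> A \<and> s \<in> A) then 0
      else if p \<notin> A \<and> q \<notin> A \<and> r \<in> A \<and> s \<in> A then 2 else 1)"
proof -
  have "{p, q, r, s} \<inter> A = {} \<longleftrightarrow> p \<notin> A \<and> q \<notin> A \<and> r \<notin> A \<and> s \<notin> A" by auto
  moreover have "{p, q, r, s} \<inter> A = {r, s} \<longleftrightarrow> p \<notin> A \<and> q \<notin> A \<and> r \<in> A \<and> s \<in> A"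
    using pqrs by blast
  ultimately show ?thesis by (simp add: stacked_fun_def)
qed

lemma base_polytope_stacked:
  "base_polytope (convex hull stacked_vertices p q r s) (stacked_fun p q r s)"
proof (rule base_polytope_convex_hull)
  show "finite (stacked_vertices p q r s)" by (rule finite_stacked_vertices)
next
  fix x A assume "x \<in> stacked_vertices p q r s"
  then consider "x = apex p q r s" | i j where "x = root_vector i j" "i \<in> {p, q, r, s}" "j \<in> {p, q, r, s}"
    by (auto simp: stacked_vertices_def)
  then have "weight x A \<le> stacked_fun p q r s A \<and> weight x UNIV = stacked_fun p q r s UNIV"
  proof cases
    case 1
    then show ?thesis by (simp add: weight_apex stacked_fun_eq)
  next
    case 2
    then show ?thesis by (auto simp: weight_root stacked_fun_eq)
  qed
  then show "weight x A \<le> stacked_fun p q r s A" "weight x UNIV = stacked_fun p q r s UNIV" by auto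
next
  fix c :: "'n \<Rightarrow> nat" assume c: "ranking c"
  show "\<exists>x\<in>stacked_vertices p q r s. \<forall>t. weight x {i. c i < t} = stacked_fun p q r s {i. c i < t}"
  proof (cases "max (c r) (c s) < min (c p) (c q)")
    \<comment> \<open>Only if \<open>r\<close> and \<open>s\<close> both precede \<open>p\<close>
      and \<open>q\<close> does a segment have trace \<open>{r, s}\<close>, and then the apex is
      tight. Otherwise the root from the first to the last of the four elements is.\<close>
    case True
    then have "weight (apex p q r s) {i. c i < t} = stacked_fun p q r s {i. c i < t}" for t
      by (auto simp: weight_apex stacked_fun_eq)
    then show ?thesis unfolding stacked_vertices_def by blast
  next
    case False
    let ?F = "{p, q, r, s}"
    have "Min (c ` ?F) \<in> c ` ?F" "Max (c ` ?F) \<in> c ` ?F" by (rule Min_in Max_in; simp)+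
    then obtain i j where i: "i \<in> ?F" "c i = Min (c ` ?F)" and j: "j \<in> ?F" "c j = Max (c ` ?F)"
      unfolding image_iff by metis
    have i_min: "c i \<le> c k" if "k \<in> ?F" for k unfolding i(2) using that by (intro Min_le) auto
    have j_max: "c k \<le> c j" if "k \<in> ?F" for k unfolding j(2) using that by (intro Max_ge) auto
    have "i \<noteq> j"
    proof
      assume "i = j"
      then have "c p = c q" using i_min[of p] i_min[of q] j_max[of p] j_max[of q] by simp
      then show False using rankingD(1)[OF c] pqrs by blast
    qed
    moreover have "weight (root_vector i j) {k. c k < t} = stacked_fun p q r s {k. c k < t}" for t
    proof -
      have "c i < t \<longleftrightarrow> c p < t \<or> c q < t \<or> c r < t \<or> c s < t"
        using i(1) i_min[of p] i_min[of q] i_min[of r] i_min[of s] by auto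
      moreover have "c j < t \<longleftrightarrow> c p < t \<and> c q < t \<and> c r < t \<and> c s < t"
        using j(1) j_max[of p] j_max[of q] j_max[of r] j_max[of s] by auto
      ultimately show ?thesis using False by (simp add: weight_root stacked_fun_eq) linarith
    qed
    ultimately show ?thesis using i(1) j(1) unfolding stacked_vertices_def by blast
  qed
qed

lemma extreme_stacked_fun: "extreme_submodular (stacked_fun p q r s)" (is "extreme_submodular ?f")
proof (rule extreme_submodularI[where e = p])
  show "?f {} = 0" by (simp add: stacked_fun_eq)
  fix g :: "'n set \<Rightarrow> real"
  assume g0: "g {} = 0" and sub: "\<And>A B. g (A \<inter> B) + g (A \<union> B) \<le> g A + g B"
    and tight: "\<And>A B. ?f A + ?f B = ?f (A \<inter> B) + ?f (A \<union> B) \<Longrightarrow> g A + g B = g (A \<inter> B) + g (A \<union> B)"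
    and marg: "\<And>S T i. S \<subseteq> T \<Longrightarrow> i \<notin> T \<Longrightarrow> ?f (insert i S) - ?f S = ?f (insert i T) - ?f T \<Longrightarrow>
         g (insert i S) - g S = g (insert i T) - g T"
  have sq: "g A + g B = g C + g D"
    if "A \<inter> B = C" "A \<union> B = D" "?f A + ?f B = ?f C + ?f D" for A B C D
    using tight[of A B] that by simp
  note [simp] = stacked_fun_eq pqrs
  \<comment> \<open>Tight pairs inside \<open>{p, q, r, s}\<close>; they suffice to express all
    marginals there, except those of \<open>p\<close>, through \<open>l\<close> and
    \<open>z\<close>.\<close>
  have eqs: "g {r} + g {s} = g {} + g {r, s}"
    "g {p, q} + g {p, r} = g {p} + g {p, q, r}"
    "g {p, q} + g {p, s} = g {p} + g {p, q, s}"
    "g {p, r} + g {p, s} = g {p} + g {p, r, s}"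
    "g {p, q} + g {q, r} = g {q} + g {p, q, r}"
    "g {p, q} + g {q, s} = g {q} + g {p, q, s}"
    "g {q, r} + g {q, s} = g {q} + g {q, r, s}"
    "g {p, r} + g {q, r} = g {r} + g {p, q, r}"
    "g {p, s} + g {q, s} = g {s} + g {p, q, s}"
    "g {p, r, s} + g {q, r, s} = g {r, s} + g {p, q, r, s}"
    by (rule sq; auto)+
  \<comment> \<open>The defect of \<open>f\<close> at \<open>{p}\<close>, \<open>{q}\<close> is 1,
    so the scaling factor has to be the defect of \<open>g\<close> there.\<close>
  define l where "l = g {p} + g {q} - g {p, q}"
  have "0 \<le> l" using sub[of "{p}" "{q}"] g0 by (simp add: l_def insert_commute)
  \<comment> \<open>For \<open>q\<close>, \<open>r\<close>, \<open>s\<close> the marginal over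
    \<open>{p}\<close> is used, since that of \<open>f\<close> vanishes there.\<close>
  define z where "z i = (if i \<in> {q, r, s} then g {p, i} - g {p} else g {i})" for i
  have z: "z q = g {p, q} - g {p}" "z r = g {p, r} - g {p}" "z s = g {p, s} - g {p}"
    "i \<notin> {q, r, s} \<Longrightarrow> z i = g {i}" for i
    by (simp_all add: z_def)
  have "g (insert i S) - g S = l * (?f (insert i S) - ?f S) + z i" if i: "i \<noteq> p" "i \<notin> S" for i S
  proof (cases "i \<in> {q, r, s}")
    case False
    then have "p \<noteq> i" "q \<noteq> i" "r \<noteq> i" "s \<noteq> i" using i by auto
    then have f0: "?f (insert i S) - ?f S = 0" "?f {i} - ?f {} = 0" by simp_all
    then have "g (insert i S) - g S = g {i} - g {}" using marg[of "{}" S i] i by simp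
    then show ?thesis using f0(1) g0 z(4)[OF False] by simp
  next
    case True
    \<comment> \<open>The trace of \<open>A\<close> on the four elements, spelled out so that case
      distinctions turn it into the literal sets of \<open>eqs\<close>.\<close>
    define C where "C A = (if p \<in> A then insert p else id) ((if q \<in> A then insert q else id)
      ((if r \<in> A then insert r else id) (if s \<in> A then {s} else {})))" for A
    have C: "C A = {p, q, r, s} \<inter> A" for A by (auto simp: C_def)
    have "insert i (C S) = C (insert i S)" using True by (auto simp: C)
    moreover have "?f (C A) = ?f A" for A by (simp add: C)
    moreover have "C S \<subseteq> S" by (simp add: C)
    ultimately have "g (C (insert i S)) - g (C S) = g (insert i S) - g S"
      using marg[of "C S" S i] i by simp
    moreover have "g (C (insert i S)) - g (C S) = l * (?f (insert i S) - ?f S) + z i"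
    proof -
      consider "i = q" "q \<notin> S" | "i = r" "r \<notin> S" | "i = s" "s \<notin> S" using True i by blast
      then show ?thesis
        using eqs g0
        by cases (cases "p \<in> S"; cases "q \<in> S"; cases "r \<in> S"; cases "s \<in> S";
            simp add: C_def z l_def)+
    qed
    ultimately show ?thesis by simp
  qed
  then show "\<exists>l\<ge>0. \<exists>z. \<forall>i S. i \<noteq> p \<longrightarrow> i \<notin> S \<longrightarrow>
      g (insert i S) - g S = l * (?f (insert i S) - ?f S) + z i"
    using \<open>0 \<le> l\<close> by blast
qed

text \<open>The marginals of \<open>r\<close> over the three chosen sets are 1, 0 and -1.\<close>

lemma stacked_not_matroidal:
  "\<not> (\<exists>\<B>. matroid_bases \<B> \<and>
       normally_equivalent (convex hull stacked_vertices p q r s) (matroid_polytope \<B>))"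
  by (rule base_polytope_not_matroidal[OF base_polytope_stacked extreme_stacked_fun,
        of r "{}" "{p}" "{p, q, s}"])
    (use pqrs in \<open>auto simp: stacked_fun_eq\<close>)

lemma stacked_exposed:
  assumes "v \<in> stacked_vertices p q r s"
  shows "\<exists>w. \<forall>u\<in>stacked_vertices p q r s - {v}. w \<bullet> u < w \<bullet> v"
proof (cases "v = apex p q r s")
  case True
  define w :: "real ^ 'n" where "w = (\<chi> k. if k \<in> {p, q} then - 1 else 1)"
  have w: "w $ p = - 1" "w $ q = - 1" "w $ r = 1" "w $ s = 1" using pqrs by (simp_all add: w_def)
  have "w $ i - w $ j \<le> 2" for i j by (simp add: w_def)
  then have "\<forall>u\<in>stacked_vertices p q r s - {v}. w \<bullet> u < w \<bullet> v"
    by (auto simp: True stacked_vertices_def apex_def inner_add_right inner_root w intro: le_less_trans)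
  then show ?thesis by blast
next
  case False
  then obtain i j where v: "v = root_vector i j" and ij: "i \<in> {p, q, r, s}" "j \<in> {p, q, r, s}" "i \<noteq> j"
    using assms by (auto simp: stacked_vertices_def)
  \<comment> \<open>The values at \<open>i\<close> and \<open>j\<close> single out the root among
    the roots. The remaining signs oppose the apex, keeping it below 4.\<close>
  define w :: "real ^ 'n" where
    "w = (\<chi> k. if k = i then 2 else if k = j then - 2 else if k \<in> {p, q} then 1 else - 1)"
  have "w \<bullet> apex p q r s < 4"
    using ij pqrs by (auto simp: apex_def inner_add_right inner_root w_def)
  have "w $ a - w $ b < 4" if "a \<noteq> i \<or> b \<noteq> j" for a b
    using that by (auto simp: w_def)
  have "w \<bullet> v = 4" using ij by (simp add: v inner_root w_def)
  have "w \<bullet> u < w \<bullet> v" if "u \<in> stacked_vertices p q r s" "u \<noteq> v" for u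
  proof -
    consider "u = apex p q r s" | a b where "u = root_vector a b"
      using \<open>u \<in> stacked_vertices p q r s\<close> by (auto simp: stacked_vertices_def)
    then show ?thesis
    proof cases
      case 2
      then have "a \<noteq> i \<or> b \<noteq> j" using that(2) v by auto
      then show ?thesis using 2 \<open>w \<bullet> v = 4\<close> \<open>\<And>a b. a \<noteq> i \<or> b \<noteq> j \<Longrightarrow> w $ a - w $ b < 4\<close>
        by (simp add: inner_root)
    qed (use \<open>w \<bullet> apex p q r s < 4\<close> \<open>w \<bullet> v = 4\<close> in simp)
  qed
  then show ?thesis by blast
qed

lemma card_extreme_points_stacked:
  "card {x. x extreme_point_of (convex hull stacked_vertices p q r s)} = 13"
proof -
  let ?F = "{p, q, r, s}"
  let ?D = "?F \<times> ?F - (\<lambda>i. (i, i)) ` ?F"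
  have inj: "inj_on (\<lambda>(i, j). root_vector i j) ?D"
  proof (rule inj_onI, clarify)
    fix i j a b assume "root_vector i j = root_vector a b" "(i, j) \<notin> (\<lambda>i. (i, i)) ` ?F" "i \<in> ?F" "j \<in> ?F"
    then have "i \<noteq> j" "root_vector i j = root_vector a b" by blast+
    then show "i = a \<and> j = b" by (rule root_eqD)
  qed
  have roots: "{root_vector i j | i j. i \<in> ?F \<and> j \<in> ?F \<and> i \<noteq> j} = (\<lambda>(i, j). root_vector i j) ` ?D" by auto
  have "card ?F = 4" using pqrs by simp
  then have "card (?F \<times> ?F) = 16" by (simp only: card_cartesian_product)
  moreover have "card ((\<lambda>i. (i, i)) ` ?F) = 4"
    by (subst card_image) (auto simp: inj_on_def \<open>card ?F = 4\<close>)
  moreover have "card ?D = card (?F \<times> ?F) - card ((\<lambda>i. (i, i)) ` ?F)"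
    by (rule card_Diff_subset) auto
  ultimately have "card ?D = 12" by simp
  then have card_roots: "card {root_vector i j | i j. i \<in> ?F \<and> j \<in> ?F \<and> i \<noteq> j} = 12"
    unfolding roots using card_image[OF inj] by simp
  have "apex p q r s \<noteq> root_vector i j" for i j
  proof
    assume "apex p q r s = root_vector i j"
    then have "weight (root_vector i j) {r, s} = 2" using weight_apex[of p q r s "{r, s}"] pqrs by simp
    then show False by (auto simp: weight_root of_bool_def split: if_splits)
  qed
  moreover have "finite {root_vector i j | i j. i \<in> ?F \<and> j \<in> ?F \<and> i \<noteq> j}"
    using card_roots by (intro card_ge_0_finite) simp
  ultimately have "card (stacked_vertices p q r s) = 13"
    unfolding stacked_vertices_def using card_roots by (subst card_insert_disjoint) auto
  then show ?thesis
    by (simp only: extreme_points_convex_hull_exposed[OF finite_stacked_vertices stacked_exposed])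
qed

end

section \<open>The family\<close>

theorem corollary3p3p5:
  fixes N :: nat
  assumes "CARD('n::finite) = N" and "N \<ge> 4"
  shows "\<exists>\<P> :: (real ^ 'n) set set.
           finite \<P> \<and> card \<P> \<ge> 2 * ((N - 1) div 2) \<and>
           (\<forall>P\<in>\<P>. deformed_permutahedron P \<and> indecomposable P \<and>
                   \<not> (\<exists>\<B>. matroid_bases \<B> \<and> normally_equivalent P (matroid_polytope \<B>))) \<and>
           pairwise (\<lambda>P Q. \<not> isomorphic_polytopes P Q) \<P>"
proof -
  obtain xs :: "'n list" where xs: "set xs = UNIV" "distinct xs"
    using finite_distinct_list[OF finite] by blast
  then have "length xs \<ge> 4" using assms distinct_card[of xs] by simp
  then obtain p q r s ys where "xs = p # q # r # s # ys"
    by (auto simp: numeral_eq_Suc Suc_le_length_iff)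
  then have pqrs: "distinct [p, q, r, s]" using xs(2) by simp
  define n where "n = N - 1"
  have n: "3 \<le> n" "n = CARD('n) - 1" using assms by (simp_all add: n_def)
  \<comment> \<open>The indices with \<open>a + 2 <= b < n\<close>: there are \<open>n - 2\<close>
    of them for \<open>a = 0\<close> and \<open>n - 3\<close> for \<open>a = 1\<close>.\<close>
  define I where "I = {0::nat} \<times> {2..<n} \<union> {1} \<times> {3..<n}"
  have I: "a \<le> 1" "a + 2 \<le> b" "b < n" if "(a, b) \<in> I" for a b using that by (auto simp: I_def)
  \<comment> \<open>The coordinate \<open>p\<close> serves as the lifting coordinate of every
    slab.\<close>
  define T where "T = (\<lambda>(a, b). cube_slab p a b)"
  define H where "H = convex hull stacked_vertices p q r s"
  define \<P> where "\<P> = insert H (T ` I)"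
  define v where "v P = card {x. x extreme_point_of P}" for P :: "(real ^ 'n) set"
  have vT: "v (T (a, b)) = (\<Sum>k=a..b. n choose k)" for a b
    by (simp add: v_def T_def card_extreme_points_cube_slab n(2))
  have vH: "v H = 13" unfolding v_def H_def by (rule card_extreme_points_stacked[OF pqrs])
  have vT_inj: "x = y" if "x \<in> I" "y \<in> I" "v (T x) = v (T y)" for x y
  proof -
    obtain a b a' b' where xy: "x = (a, b)" "y = (a', b')" by (cases x, cases y)
    show ?thesis
      using slab_count_inj[of a b n a' b'] I[of a b] I[of a' b'] that n(1) unfolding xy vT by simp
  qed
  have vT_H: "v (T x) \<noteq> v H" if "x \<in> I" for x
  proof -
    obtain a b where x: "x = (a, b)" by (cases x)
    show ?thesis using slab_count_neq_13[of a b n] I[of a b] that unfolding x vT vH by simp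
  qed
  have v_inj: "P = Q" if "P \<in> \<P>" "Q \<in> \<P>" "v P = v Q" for P Q
  proof (rule ccontr)
    assume "P \<noteq> Q"
    with that(1,2) consider x where "x \<in> I" "P = H" "Q = T x" | x where "x \<in> I" "P = T x" "Q = H"
      | x y where "x \<in> I" "y \<in> I" "P = T x" "Q = T y" "x \<noteq> y"
      unfolding \<P>_def by blast
    then show False using vT_H vT_inj that(3) by cases metis+
  qed
  have base: "\<exists>f. base_polytope P f \<and> extreme_submodular f" if "P \<in> \<P>" for P
    using that unfolding \<P>_def
  proof (elim insertE imageE)
    assume "P = H"
    then show ?thesis unfolding H_def
      using base_polytope_stacked[OF pqrs] extreme_stacked_fun[OF pqrs] by blast
  next
    fix x assume x: "x \<in> I" "P = T x"
    obtain a b where ab: "x = (a, b)" by (cases x)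
    then have "a < b" "Suc b < CARD('n)" using I[of a b] x n by auto
    then have "base_polytope (cube_slab p a b) (slab_fun p a b)" "extreme_submodular (slab_fun p a b)"
      by (auto intro: base_polytope_cube_slab extreme_slab_fun)
    then show ?thesis unfolding x(2) ab T_def by auto
  qed
  have not_matroidal: "\<not> (\<exists>\<B>. matroid_bases \<B> \<and> normally_equivalent P (matroid_polytope \<B>))"
    if "P \<in> \<P>" for P
    using that unfolding \<P>_def
  proof (elim insertE imageE)
    assume "P = H"
    then show ?thesis unfolding H_def using stacked_not_matroidal[OF pqrs] by blast
  next
    fix x assume x: "x \<in> I" "P = T x"
    obtain a b where ab: "x = (a, b)" by (cases x)
    then have "a + 2 \<le> b" "Suc b < CARD('n)" using I[of a b] x n by auto
    then show ?thesis unfolding x(2) ab T_def prod.case by (rule cube_slab_not_matroidal)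
  qed
  show ?thesis
  proof (intro exI[of _ \<P>] conjI ballI)
    have fin: "finite I" by (simp add: I_def)
    then show "finite \<P>" by (simp add: \<P>_def)
    have "card I = (n - 2) + (n - 3)"
      unfolding I_def by (subst card_Un_disjoint) (auto simp: card_cartesian_product)
    moreover have "inj_on T I" using vT_inj by (intro inj_onI) metis
    moreover have "H \<notin> T ` I" using vT_H by auto
    ultimately have card: "card \<P> = Suc ((n - 2) + (n - 3))"
      using fin by (simp add: \<P>_def card_image)
    have "2 * (n div 2) \<le> card \<P>"
    \<comment> \<open>For \<open>n = 3\<close> the family has exactly 2 members, the required
      number; for larger \<open>n\<close> it has \<open>2 * n - 4\<close>, which is at least
      \<open>n\<close>.\<close>
    proof (cases "n = 3")
      case True
      then show ?thesis unfolding card by simp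
    next
      case False
      have "2 * (n div 2) \<le> n" by simp
      also have "n \<le> card \<P>" using False n(1) unfolding card by linarith
      finally show ?thesis .
    qed
    then show "2 * ((N - 1) div 2) \<le> card \<P>" unfolding n_def .
    show "pairwise (\<lambda>P Q. \<not> isomorphic_polytopes P Q) \<P>"
    proof (rule pairwiseI, rule notI)
      fix P Q assume PQ: "P \<in> \<P>" "Q \<in> \<P>" "P \<noteq> Q" "isomorphic_polytopes P Q"
      have "v P = v Q"
        unfolding v_def
        using isomorphic_polytopes_card_extreme_points[OF PQ(4)] base[OF PQ(1)] base[OF PQ(2)]
          base_polytopeD(1) by blast
      then show False using v_inj[OF PQ(1,2)] PQ(3) by simp
    qed
    fix P assume P: "P \<in> \<P>"
    show "deformed_permutahedron P" using base[OF P] base_polytope_deformed_permutahedron by blast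
    show "indecomposable P" using base[OF P] base_polytope_indecomposable by blast
    show "\<not> (\<exists>\<B>. matroid_bases \<B> \<and> normally_equivalent P (matroid_polytope \<B>))"
      using not_matroidal[OF P] .
  qed
qed

end
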